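(* Let $T$ be a complete first-order theory which is dependent, $\mathfrak{C}$ a $\bar\kappa$-saturated model of $T$ with $\bar\kappa$ strongly inaccessible and $\bar\kappa>|T|$. Let $A_*\subseteq\mathfrak{C}$, $|A_*|<\bar\kappa$, let $p_*(x)$ be a type over $A_*$, and suppose a two-place function $*$, a one-place function ${}^{-1}$ and an element $e_G$, all first-order definable with parameters from $A_*$, restrict to a group structure $G$ on $p_*(\mathfrak{C})$, and assume $G$ is abelian. Then there is a set $\mathbf P\subseteq\mathbf S(A_* )$ of complete 1-types over $A_*$ such that: (a) $\mathbf P(\mathfrak{C}):=\bigcup\{p(\mathfrak{C}):p\in\mathbf P\}$ is a subgroup of $G$ of bounded index, i.e. $(G:\mathbf P(\mathfrak{C}))<\bar\kappa$; (b) $(G:\mathbf P(\mathfrak{C}))\le 2^{|A_*|+|T|+\aleph_0}$; (c) $\mathbf P(\mathfrak{C})$ is minimal: if $H$ is a union-type-definable subgroup of $G$, then $H$ has bounded index in $G$ if and only if $\mathbf P(\mathfrak{C})\subseteq H$.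
   Context: $T$ is dependent means no formula has the independence property in $T$. $p(\mathfrak{C})$ is the set of realizations in $\mathfrak{C}$ of a type $p$. A subset $H\subseteq\mathfrak{C}$ is union-type-definable if $H=\bigcup\{p_i(\mathfrak{C}):i<i_*\}$ where $i_*<\bar\kappa$ and each $p_i$ is a type over a common set $A\subseteq\mathfrak{C}$ with $|A|<\bar\kappa$ (equivalently, $H=\psi(\mathfrak{C},\bar{\mathbf a})$ for some $\mathbb{L}_{\infty,\bar\kappa}(\tau_T)$-formula $\psi$ and parameters $\bar{\mathbf a}$ of length $<\bar\kappa$). Bounded index means index $<\bar\kappa$. *)

theory Defs
  imports Main "HOL-Algebra.Coset"
begin

unbundle cardinal_syntax

text \<open>A symbol of a language is a name together with its arity. Constants are function symbols of
  arity 0.\<close>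

record ('f, 'r) language =
  funs :: "('f \<times> nat) set"
  rels :: "('r \<times> nat) set"

text \<open>A structure has the (nonempty) type \<open>'a\<close> as its universe. The \<open>n\<close>-ary symbol \<open>(f, n)\<close> is
  interpreted by \<open>fn_of M f\<close> on lists of length \<open>n\<close>; values on lists of other lengths, and at names
  that do not occur in the language, play no role.\<close>

record ('f, 'r, 'a) struct =
  fn_of :: "'f \<Rightarrow> 'a list \<Rightarrow> 'a"
  rel_of :: "'r \<Rightarrow> 'a list \<Rightarrow> bool"

text \<open>First-order formulas with equality. \<open>Par a\<close> is the name of the element \<open>a\<close> of the universe, so
  that formulas with parameters are formulas in which \<open>Par\<close> occurs.\<close>

datatype ('f, 'a) tm = Var nat | Par 'a | Fn 'f "('f, 'a) tm list"

datatype ('f, 'r, 'a) fm =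
    Equal "('f, 'a) tm" "('f, 'a) tm"
  | Atom 'r "('f, 'a) tm list"
  | Neg "('f, 'r, 'a) fm"
  | Conj "('f, 'r, 'a) fm" "('f, 'r, 'a) fm"
  | Exi nat "('f, 'r, 'a) fm"

fun eval :: "('f, 'r, 'a) struct \<Rightarrow> (nat \<Rightarrow> 'a) \<Rightarrow> ('f, 'a) tm \<Rightarrow> 'a" where
  "eval M v (Var i) = v i"
| "eval M v (Par a) = a"
| "eval M v (Fn f ts) = fn_of M f (map (eval M v) ts)"

fun sat :: "('f, 'r, 'a) struct \<Rightarrow> (nat \<Rightarrow> 'a) \<Rightarrow> ('f, 'r, 'a) fm \<Rightarrow> bool" where
  "sat M v (Equal s t) \<longleftrightarrow> eval M v s = eval M v t"
| "sat M v (Atom r ts) \<longleftrightarrow> rel_of M r (map (eval M v) ts)"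
| "sat M v (Neg \<phi>) \<longleftrightarrow> \<not> sat M v \<phi>"
| "sat M v (Conj \<phi> \<psi>) \<longleftrightarrow> sat M v \<phi> \<and> sat M v \<psi>"
| "sat M v (Exi i \<phi>) \<longleftrightarrow> (\<exists>a. sat M (v(i := a)) \<phi>)"

fun wf_tm :: "('f, 'r) language \<Rightarrow> ('f, 'a) tm \<Rightarrow> bool" where
  "wf_tm L (Var i) \<longleftrightarrow> True"
| "wf_tm L (Par a) \<longleftrightarrow> True"
| "wf_tm L (Fn f ts) \<longleftrightarrow> (f, length ts) \<in> funs L \<and> (\<forall>t\<in>set ts. wf_tm L t)"

fun wf_fm :: "('f, 'r) language \<Rightarrow> ('f, 'r, 'a) fm \<Rightarrow> bool" where
  "wf_fm L (Equal s t) \<longleftrightarrow> wf_tm L s \<and> wf_tm L t"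
| "wf_fm L (Atom r ts) \<longleftrightarrow> (r, length ts) \<in> rels L \<and> (\<forall>t\<in>set ts. wf_tm L t)"
| "wf_fm L (Neg \<phi>) \<longleftrightarrow> wf_fm L \<phi>"
| "wf_fm L (Conj \<phi> \<psi>) \<longleftrightarrow> wf_fm L \<phi> \<and> wf_fm L \<psi>"
| "wf_fm L (Exi i \<phi>) \<longleftrightarrow> wf_fm L \<phi>"

fun vars_tm :: "('f, 'a) tm \<Rightarrow> nat set" where
  "vars_tm (Var i) = {i}"
| "vars_tm (Par a) = {}"
| "vars_tm (Fn f ts) = (\<Union>t\<in>set ts. vars_tm t)"

fun free_vars :: "('f, 'r, 'a) fm \<Rightarrow> nat set" where
  "free_vars (Equal s t) = vars_tm s \<union> vars_tm t"
| "free_vars (Atom r ts) = (\<Union>t\<in>set ts. vars_tm t)"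
| "free_vars (Neg \<phi>) = free_vars \<phi>"
| "free_vars (Conj \<phi> \<psi>) = free_vars \<phi> \<union> free_vars \<psi>"
| "free_vars (Exi i \<phi>) = free_vars \<phi> - {i}"

fun params_tm :: "('f, 'a) tm \<Rightarrow> 'a set" where
  "params_tm (Var i) = {}"
| "params_tm (Par a) = {a}"
| "params_tm (Fn f ts) = (\<Union>t\<in>set ts. params_tm t)"

fun params :: "('f, 'r, 'a) fm \<Rightarrow> 'a set" where
  "params (Equal s t) = params_tm s \<union> params_tm t"
| "params (Atom r ts) = (\<Union>t\<in>set ts. params_tm t)"
| "params (Neg \<phi>) = params \<phi>"
| "params (Conj \<phi> \<psi>) = params \<phi> \<union> params \<psi>"
| "params (Exi i \<phi>) = params \<phi>"

text \<open>The \<open>L\<close>-formulas with parameters from \<open>A\<close> and free variables among \<open>V\<close>.\<close>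

definition formulas :: "('f, 'r) language \<Rightarrow> 'a set \<Rightarrow> nat set \<Rightarrow> ('f, 'r, 'a) fm set" where
  "formulas L A V = {\<phi>. wf_fm L \<phi> \<and> params \<phi> \<subseteq> A \<and> free_vars \<phi> \<subseteq> V}"

text \<open>A complete theory is deductively closed, so its cardinality is that of the set of all
  \<open>L\<close>-formulas, as in the usual convention for \<open>|T|\<close>. Its consistency also follows as soon as it
  has a model.\<close>

definition complete_theory :: "('f, 'r) language \<Rightarrow> ('f, 'r, 'a) fm set \<Rightarrow> bool" where
  "complete_theory L T \<longleftrightarrow>
     T \<subseteq> formulas L {} {} \<and> (\<forall>\<phi>\<in>formulas L {} {}. \<phi> \<in> T \<longleftrightarrow> Neg \<phi> \<notin> T)"

definition is_model :: "('f, 'r, 'a) struct \<Rightarrow> ('f, 'r, 'a) fm set \<Rightarrow> bool" where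
  "is_model M T \<longleftrightarrow> (\<forall>\<phi>\<in>T. \<forall>v. sat M v \<phi>)"

text \<open>The set \<open>X\<close> splits the free variables of \<open>\<phi>\<close> into a tuple \<open>x\<close> (those in \<open>X\<close>) and a tuple \<open>y\<close>
  (the others). The formula \<open>\<phi>(x; y)\<close> has the independence property in \<open>M\<close> if for every \<open>n\<close> there are
  tuples \<open>b 0, \<dots>, b (n - 1)\<close> such that for each \<open>w \<subseteq> {0, \<dots>, n - 1}\<close> some tuple \<open>a\<close> satisfies \<open>\<phi>(a; b i)\<close>
  exactly for \<open>i \<in> w\<close>. Tuples are given as valuations; only their values at the relevant free
  variables matter.\<close>

definition has_IP :: "('f, 'r, 'a) struct \<Rightarrow> ('f, 'r, 'a) fm \<Rightarrow> nat set \<Rightarrow> bool" where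
  "has_IP M \<phi> X \<longleftrightarrow>
     (\<forall>n. \<exists>b :: nat \<Rightarrow> nat \<Rightarrow> 'a. \<forall>w \<subseteq> {..<n}. \<exists>a :: nat \<Rightarrow> 'a. \<forall>i<n.
        sat M (\<lambda>k. if k \<in> X then a k else b i k) \<phi> \<longleftrightarrow> i \<in> w)"

text \<open>The models of \<open>T\<close> considered here are those with universe \<open>'a\<close>. As each instance of the
  independence property is a first-order sentence, all models of a complete theory agree on it.\<close>

definition dependent_theory :: "('f, 'r) language \<Rightarrow> ('f, 'r, 'a) fm set \<Rightarrow> bool" where
  "dependent_theory L T \<longleftrightarrow>
     \<not> (\<exists>M. is_model M T \<and> (\<exists>\<phi>\<in>formulas L {} UNIV. \<exists>X. has_IP M \<phi> X))"

text \<open>Types in one variable, which is \<open>Var 0\<close>. Consistency with the elementary diagram of \<open>M\<close> is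
  finite satisfiability in \<open>M\<close>; the valuation \<open>\<lambda>_. a\<close> assigns \<open>a\<close> to that variable.\<close>

definition type_over ::
    "('f, 'r) language \<Rightarrow> ('f, 'r, 'a) struct \<Rightarrow> 'a set \<Rightarrow> ('f, 'r, 'a) fm set \<Rightarrow> bool" where
  "type_over L M A p \<longleftrightarrow>
     p \<subseteq> formulas L A {0} \<and> (\<forall>q \<subseteq> p. finite q \<longrightarrow> (\<exists>a. \<forall>\<phi>\<in>q. sat M (\<lambda>_. a) \<phi>))"

definition complete_types ::
    "('f, 'r) language \<Rightarrow> ('f, 'r, 'a) struct \<Rightarrow> 'a set \<Rightarrow> ('f, 'r, 'a) fm set set" where
  "complete_types L M A =
     {p. type_over L M A p \<and> (\<forall>\<phi>\<in>formulas L A {0}. \<phi> \<in> p \<or> Neg \<phi> \<in> p)}"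

definition realizations :: "('f, 'r, 'a) struct \<Rightarrow> ('f, 'r, 'a) fm set \<Rightarrow> 'a set" where
  "realizations M p = {a. \<forall>\<phi>\<in>p. sat M (\<lambda>_. a) \<phi>}"

definition union_realizations ::
    "('f, 'r, 'a) struct \<Rightarrow> ('f, 'r, 'a) fm set set \<Rightarrow> 'a set" where
  "union_realizations M P = (\<Union>p\<in>P. realizations M p)"

text \<open>\<open>\<kappa>\<close> is a cardinal, given as a well-order. The cardinals below \<open>\<kappa>\<close> are, up to isomorphism,
  the cardinalities below \<open>\<kappa>\<close> of subsets of its field.\<close>

definition strongly_inaccessible :: "'k rel \<Rightarrow> bool" where
  "strongly_inaccessible \<kappa> \<longleftrightarrow>
     Card_order \<kappa> \<and> natLeq <o \<kappa> \<and> regularCard \<kappa> \<and>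
     (\<forall>B \<subseteq> Field \<kappa>. |B| <o \<kappa> \<longrightarrow> |Pow B| <o \<kappa>)"

definition saturated ::
    "('f, 'r) language \<Rightarrow> 'k rel \<Rightarrow> ('f, 'r, 'a) struct \<Rightarrow> bool" where
  "saturated L \<kappa> M \<longleftrightarrow>
     (\<forall>A p. |A| <o \<kappa> \<and> type_over L M A p \<longrightarrow> realizations M p \<noteq> {})"

definition union_type_definable ::
    "('f, 'r) language \<Rightarrow> 'k rel \<Rightarrow> ('f, 'r, 'a) struct \<Rightarrow> 'a set \<Rightarrow> bool" where
  "union_type_definable L \<kappa> M H \<longleftrightarrow>
     (\<exists>A P. |A| <o \<kappa> \<and> |P| <o \<kappa> \<and> (\<forall>p\<in>P. type_over L M A p) \<and> H = union_realizations M P)"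

text \<open>First-order definability over \<open>A\<close> of an \<open>n\<close>-ary relation \<open>R\<close>, where \<open>R\<close> is given as a predicate
  of \<open>v 0, \<dots>, v (n - 1)\<close>.\<close>

definition definable_over ::
    "('f, 'r) language \<Rightarrow> ('f, 'r, 'a) struct \<Rightarrow> 'a set \<Rightarrow> nat \<Rightarrow> ((nat \<Rightarrow> 'a) \<Rightarrow> bool) \<Rightarrow> bool" where
  "definable_over L M A n R \<longleftrightarrow> (\<exists>\<phi>\<in>formulas L A {..<n}. \<forall>v. sat M v \<phi> \<longleftrightarrow> R v)"

text \<open>The index of \<open>H\<close> in \<open>G\<close>, as a cardinal.\<close>

definition index :: "('a, 'b) monoid_scheme \<Rightarrow> 'a set \<Rightarrow> 'a set rel" where
  "index G H = |rcosets\<^bsub>G\<^esub> H|"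

end

theory Submission
  imports Defs "HOL-Algebra.FiniteProduct" "HOL-Algebra.Generated_Groups" "HOL-Library.Ramsey"
    "HOL-Library.Nat_Bijection"
begin

text \<open>
  For a finite set \<open>\<Delta>\<close> of formulas and parameters \<open>d\<close>, let \<open>D(\<Delta>, d)\<close> be the set of quotients \<open>y / z\<close> of
  elements of \<open>G\<close> that agree on all \<open>\<phi>(x, d)\<close> with \<open>\<phi> \<in> \<Delta>\<close>, and let \<open>Q\<close> be the intersection of all
  \<open>D(\<Delta>, d)\<^sup>3\<close>, over all \<open>\<Delta>\<close> and all \<open>d\<close> in the model. The subgroup generated by \<open>Q\<close> is the required one.

  Bounded index: if \<open>a\<^sub>i \<notin> D(\<Delta>, d\<^sub>i)\<^sup>3\<close> and \<open>a\<^sub>j \<in> D(\<Delta>, d\<^sub>i)\<close> for all \<open>i < j\<close>, then after thinning out by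
  Ramsey's theorem the products \<open>b w\<close> of all \<open>a\<^sub>i / a\<^sub>i\<^sub>+\<^sub>1\<close> with \<open>i = 2 k\<close> and \<open>k \<in> w\<close> satisfy
  \<open>b w \<in> D(\<Delta>, d\<^sub>i)\<close>, where \<open>i = 2 j\<close>, if and only if \<open>j \<notin> w\<close>,
  which is the independence property; commutativity makes \<open>b w\<close> a single quotient. Hence such
  sequences are finite, and a maximal one yields finitely many \<open>d\<^sub>i\<close> with
  \<open>\<Inter>\<^sub>i D(\<Delta>, d\<^sub>i) \<subseteq> D(\<Delta>, d)\<^sup>3\<close> for every \<open>d\<close>. Let \<open>B\<close> collect these \<open>d\<^sub>i\<close> for all \<open>\<Delta>\<close>; then elements of the
  same type over \<open>B\<close> have their quotient in \<open>Q\<close>.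

  Minimality: if \<open>H\<close> has bounded index and is invariant over a small set, enlarge this set to \<open>N\<close> by
  representatives of the cosets of \<open>H\<close>. Elements of the same type over \<open>N\<close> lie in the same coset,
  and by saturation every element of \<open>Q\<close> is a product of three quotients of such elements.
\<close>

section \<open>Syntax\<close>

fun subst_tm :: "(nat \<Rightarrow> ('f, 'a) tm) \<Rightarrow> ('a \<Rightarrow> ('f, 'a) tm) \<Rightarrow> ('f, 'a) tm \<Rightarrow> ('f, 'a) tm" where
  "subst_tm s g (Var i) = s i"
| "subst_tm s g (Par a) = g a"
| "subst_tm s g (Fn f ts) = Fn f (map (subst_tm s g) ts)"

text \<open>Quantified variables are renamed by \<open>b\<close>, irrespective of \<open>s\<close>; variable capture is not prevented.\<close>

fun subst_fm :: "(nat \<Rightarrow> ('f, 'a) tm) \<Rightarrow> ('a \<Rightarrow> ('f, 'a) tm) \<Rightarrow> (nat \<Rightarrow> nat) \<Rightarrow>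
    ('f, 'r, 'a) fm \<Rightarrow> ('f, 'r, 'a) fm" where
  "subst_fm s g b (Equal t u) = Equal (subst_tm s g t) (subst_tm s g u)"
| "subst_fm s g b (Atom r ts) = Atom r (map (subst_tm s g) ts)"
| "subst_fm s g b (Neg \<phi>) = Neg (subst_fm s g b \<phi>)"
| "subst_fm s g b (Conj \<phi> \<psi>) = Conj (subst_fm s g b \<phi>) (subst_fm s g b \<psi>)"
| "subst_fm s g b (Exi i \<phi>) = Exi (b i) (subst_fm s g b \<phi>)"

lemma eval_cong: "(\<And>i. i \<in> vars_tm t \<Longrightarrow> v i = w i) \<Longrightarrow> eval M v t = eval M w t"
proof (induction t)
  case (Fn f ts)
  have "eval M v t = eval M w t" if "t \<in> set ts" for t
    using that Fn.prems by (intro Fn.IH) auto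
  then have "map (eval M v) ts = map (eval M w) ts" by simp
  then show ?case by (simp del: map_eq_conv)
qed auto

lemma sat_cong: "(\<And>i. i \<in> free_vars \<phi> \<Longrightarrow> v i = w i) \<Longrightarrow> sat M v \<phi> = sat M w \<phi>"
proof (induction \<phi> arbitrary: v w)
  case (Equal s t)
  then show ?case using eval_cong[of s v w M] eval_cong[of t v w M] by auto
next
  case (Atom r ts)
  then have "map (eval M v) ts = map (eval M w) ts" by (auto intro!: eval_cong)
  then show ?case by (simp del: map_eq_conv)
next
  case (Neg \<phi>)
  have "sat M v \<phi> = sat M w \<phi>" by (rule Neg.IH) (use Neg.prems in auto)
  then show ?case by simp
next
  case (Conj \<phi> \<psi>)
  have "sat M v \<phi> = sat M w \<phi>" by (rule Conj.IH) (use Conj.prems in auto)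
  moreover have "sat M v \<psi> = sat M w \<psi>" by (rule Conj.IH) (use Conj.prems in auto)
  ultimately show ?case by simp
next
  case (Exi i \<phi>)
  have "sat M (v(i := a)) \<phi> = sat M (w(i := a)) \<phi>" for a
    by (rule Exi.IH) (use Exi.prems in auto)
  then show ?case by simp
qed

lemma finite_vars_tm: "finite (vars_tm t)" by (induction t) auto

lemma finite_free_vars: "finite (free_vars \<phi>)" by (induction \<phi>) (auto simp: finite_vars_tm)

lemma finite_params_tm: "finite (params_tm t)" by (induction t) auto

lemma finite_params: "finite (params \<phi>)" by (induction \<phi>) (auto simp: finite_params_tm)

lemma wf_subst_tm:
  "wf_tm L t \<Longrightarrow> (\<And>i. wf_tm L (s i)) \<Longrightarrow> (\<And>a. wf_tm L (g a)) \<Longrightarrow> wf_tm L (subst_tm s g t)"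
  by (induction t) auto

lemma wf_subst_fm:
  "wf_fm L \<phi> \<Longrightarrow> (\<And>i. wf_tm L (s i)) \<Longrightarrow> (\<And>a. wf_tm L (g a)) \<Longrightarrow> wf_fm L (subst_fm s g b \<phi>)"
  by (induction \<phi>) (auto simp: wf_subst_tm)

lemma params_subst_tm:
  "(\<And>i. params_tm (s i) \<subseteq> X) \<Longrightarrow> (\<And>a. a \<in> params_tm t \<Longrightarrow> params_tm (g a) \<subseteq> X) \<Longrightarrow>
    params_tm (subst_tm s g t) \<subseteq> X"
proof (induction t)
  case (Fn f ts)
  have "params_tm (subst_tm s g t) \<subseteq> X" if "t \<in> set ts" for t
    using that Fn.prems by (intro Fn.IH) auto
  then show ?case by auto
qed auto

lemma params_subst_fm:
  "(\<And>i. params_tm (s i) \<subseteq> X) \<Longrightarrow> (\<And>a. a \<in> params \<phi> \<Longrightarrow> params_tm (g a) \<subseteq> X) \<Longrightarrow>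
    params (subst_fm s g b \<phi>) \<subseteq> X"
proof (induction \<phi>)
  case (Equal t u)
  then show ?case using params_subst_tm[of s X t g] params_subst_tm[of s X u g] by auto
next
  case (Atom r ts)
  have "params_tm (subst_tm s g t) \<subseteq> X" if "t \<in> set ts" for t
    using that Atom.prems by (intro params_subst_tm) auto
  then show ?case by auto
qed auto

lemma eval_subst_tm:
  "(\<And>i. s i = Var (f i)) \<Longrightarrow> (\<And>a. a \<in> params_tm t \<Longrightarrow> eval M v (g a) = a) \<Longrightarrow>
    eval M v (subst_tm s g t) = eval M (v \<circ> f) t"
proof (induction t)
  case (Fn h ts)
  have "eval M v (subst_tm s g t) = eval M (v \<circ> f) t" if "t \<in> set ts" for t
    using that Fn.prems by (intro Fn.IH) auto
  then have "map (eval M v \<circ> subst_tm s g) ts = map (eval M (v \<circ> f)) ts" by simp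
  then show ?case by (simp add: comp_def del: map_eq_conv)
qed auto

text \<open>Free and bound variables are renamed by the same injective \<open>f\<close>, so an
  update at \<open>f i\<close> corresponds exactly to an update at \<open>i\<close>. The terms
  \<open>g a\<close> have no variable in \<open>range f\<close>, hence no renamed quantifier
  captures them or changes their value.\<close>

lemma sat_subst_fm:
  assumes "inj f" and s: "\<And>i. s i = Var (f i)"
  shows "(\<And>a. a \<in> params \<phi> \<Longrightarrow> eval M v (g a) = a \<and> vars_tm (g a) \<inter> range f = {}) \<Longrightarrow>
    sat M v (subst_fm s g f \<phi>) = sat M (v \<circ> f) \<phi>"
proof (induction \<phi> arbitrary: v)
  case (Equal t u)
  have "eval M v (subst_tm s g t) = eval M (v \<circ> f) t" "eval M v (subst_tm s g u) = eval M (v \<circ> f) u"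
    by (rule eval_subst_tm; use s Equal in auto)+
  then show ?case by (simp add: comp_def)
next
  case (Atom r ts)
  have "eval M v (subst_tm s g t) = eval M (v \<circ> f) t" if "t \<in> set ts" for t
    using that Atom.prems by (intro eval_subst_tm s) auto
  then have "map (eval M v \<circ> subst_tm s g) ts = map (eval M (v \<circ> f)) ts" by simp
  then show ?case by (simp add: comp_def del: map_eq_conv)
next
  case (Exi i \<phi>)
  have "sat M (v(f i := a)) (subst_fm s g f \<phi>) = sat M ((v \<circ> f)(i := a)) \<phi>" for a
  proof -
    have "eval M (v(f i := a)) (g c) = c \<and> vars_tm (g c) \<inter> range f = {}" if "c \<in> params \<phi>" for c
    proof -
      have *: "eval M v (g c) = c" "vars_tm (g c) \<inter> range f = {}" using Exi.prems that by auto
      have "eval M (v(f i := a)) (g c) = eval M v (g c)"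
        by (rule eval_cong) (use *(2) in auto)
      then show ?thesis using * by simp
    qed
    then have "sat M (v(f i := a)) (subst_fm s g f \<phi>) = sat M (v(f i := a) \<circ> f) \<phi>"
      by (rule Exi.IH)
    moreover have "v(f i := a) \<circ> f = (v \<circ> f)(i := a)"
      using \<open>inj f\<close> by (auto simp: fun_eq_iff inj_eq)
    ultimately show ?thesis by simp
  qed
  then show ?case by (simp add: comp_def)
qed auto

section \<open>Trading parameters for variables\<close>

text \<open>Even variables carry the original variables, odd ones the parameters, with
  \<open>a\<close> at position \<open>h a\<close>. Quantified variables stay even, so they cannot
  capture a variable that stands for a parameter.\<close>

definition abstract :: "('a \<Rightarrow> nat) \<Rightarrow> ('f, 'r, 'a) fm \<Rightarrow> ('f, 'r, 'a) fm" where
  "abstract h = subst_fm (\<lambda>i. Var (2 * i)) (\<lambda>a. Var (Suc (2 * h a))) (\<lambda>i. 2 * i)"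

text \<open>Undoes \<open>abstract\<close> once \<open>xs\<close> lists the parameters at the
  positions \<open>h\<close>; this allows formulas over a set to be counted by lists of parameters
  and parameter-free formulas.\<close>

definition concretize :: "'a list \<Rightarrow> ('f, 'r, 'a) fm \<Rightarrow> ('f, 'r, 'a) fm" where
  "concretize xs =
     subst_fm (\<lambda>i. if even i then Var (i div 2) else Par (xs ! (i div 2))) Par (\<lambda>i. i div 2)"

lemma concretize_abstract:
  assumes "\<And>a. a \<in> params \<phi> \<Longrightarrow> xs ! h a = a"
  shows "concretize xs (abstract h \<phi>) = \<phi>"
proof -
  let ?s = "\<lambda>i. Var (2 * i)" and ?g = "\<lambda>a. Var (Suc (2 * h a))"
  let ?s' = "\<lambda>i. if even i then Var (i div 2) else Par (xs ! (i div 2))"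
  have tm: "subst_tm ?s' Par (subst_tm ?s ?g t) = t"
    if "\<And>a. a \<in> params_tm t \<Longrightarrow> xs ! h a = a" for t :: "('b, 'a) tm"
    using that
  proof (induction t)
    case (Fn f ts)
    have "subst_tm ?s' Par (subst_tm ?s ?g t) = t" if "t \<in> set ts" for t
      using that Fn.prems by (intro Fn.IH) auto
    then show ?case by (simp add: map_idI)
  qed auto
  show ?thesis
    unfolding concretize_def abstract_def using assms
  proof (induction \<phi>)
    case (Atom r ts)
    have "subst_tm ?s' Par (subst_tm ?s ?g t) = t" if "t \<in> set ts" for t
      using that Atom.prems by (intro tm) auto
    then show ?case by (simp add: map_idI)
  qed (simp_all add: tm)
qed

lemma abstract_formulas:
  "\<phi> \<in> formulas L B V \<Longrightarrow> abstract h \<phi> \<in> formulas L {} UNIV"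
  using params_subst_fm[of "\<lambda>i. Var (2 * i)" "{}" \<phi> "\<lambda>a. Var (Suc (2 * h a))" "\<lambda>i. 2 * i"]
  unfolding formulas_def abstract_def by (auto intro!: wf_subst_fm)

lemma params_index:
  obtains h xs where "set xs = params \<phi>" "\<And>a. a \<in> params \<phi> \<Longrightarrow> xs ! h a = a"
proof -
  obtain xs where xs: "set xs = params \<phi>" using finite_list[OF finite_params[of \<phi>]] by blast
  then have "\<exists>i. xs ! i = a" if "a \<in> params \<phi>" for a using that by (metis in_set_conv_nth)
  then have "xs ! (SOME i. xs ! i = a) = a" if "a \<in> params \<phi>" for a using that by (metis (mono_tags, lifting) someI_ex)
  then show ?thesis using that[of xs "\<lambda>a. SOME i. xs ! i = a"] xs by blast
qed

text \<open>Dependence speaks of parameter-free formulas only, so the parameters of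
  \<open>\<phi>\<close> are moved into the fixed values \<open>c\<close> of the odd
  variables.\<close>

lemma abstract_parameters:
  assumes "\<phi> \<in> formulas L B V"
  shows "\<exists>\<phi>' c. \<phi>' \<in> formulas L {} UNIV \<and>
    (\<forall>v. sat M (\<lambda>k. if even k then v (k div 2) else c k) \<phi>' = sat M v \<phi>)"
proof -
  obtain h xs where *: "\<And>a. a \<in> params \<phi> \<Longrightarrow> xs ! h a = a" using params_index by metis
  have "sat M (\<lambda>k. if even k then v (k div 2) else xs ! (k div 2)) (abstract h \<phi>) = sat M v \<phi>" for v
  proof -
    let ?v = "\<lambda>k. if even k then v (k div 2) else xs ! (k div 2)"
    have "sat M ?v (abstract h \<phi>) = sat M (?v \<circ> (\<lambda>i. 2 * i)) \<phi>"
      unfolding abstract_def using * by (intro sat_subst_fm) (auto simp: inj_def, presburger)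
    also have "?v \<circ> (\<lambda>i. 2 * i) = v" by auto
    finally show ?thesis .
  qed
  then show ?thesis
    using abstract_formulas[OF assms, of h]
    by (intro exI[of _ "abstract h \<phi>"] exI[of _ "\<lambda>k. xs ! (k div 2)"]) simp
qed

section \<open>Existential closures\<close>

definition exs :: "nat list \<Rightarrow> ('f, 'r, 'a) fm \<Rightarrow> ('f, 'r, 'a) fm" where
  "exs xs \<phi> = foldr Exi xs \<phi>"

lemma sat_exs: "sat M v (exs xs \<phi>) \<longleftrightarrow> (\<exists>w. (\<forall>i. i \<notin> set xs \<longrightarrow> w i = v i) \<and> sat M w \<phi>)"
proof (induction xs arbitrary: v)
  case Nil
  have "(\<forall>i. w i = v i) \<longleftrightarrow> w = v" for w by auto
  then show ?case by (simp add: exs_def)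
next
  case (Cons x xs)
  have "sat M v (exs (x # xs) \<phi>) \<longleftrightarrow>
      (\<exists>a w. (\<forall>i. i \<notin> set xs \<longrightarrow> w i = (v(x := a)) i) \<and> sat M w \<phi>)"
    using Cons by (simp add: exs_def)
  also have "\<dots> \<longleftrightarrow> (\<exists>w. (\<forall>i. i \<notin> set (x # xs) \<longrightarrow> w i = v i) \<and> sat M w \<phi>)"
  proof safe
    fix w assume w: "\<forall>i. i \<notin> set (x # xs) \<longrightarrow> w i = v i" "sat M w \<phi>"
    then show "\<exists>a w. (\<forall>i. i \<notin> set xs \<longrightarrow> w i = (v(x := a)) i) \<and> sat M w \<phi>"
      by (intro exI[of _ "w x"] exI[of _ w]) auto
  qed (metis fun_upd_other list.set_intros(1,2))
  finally show ?case .
qed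

lemma free_vars_exs: "free_vars (exs xs \<phi>) = free_vars \<phi> - set xs"
  by (induction xs) (auto simp: exs_def)

lemma exs_formulas: "\<phi> \<in> formulas L B V \<Longrightarrow> exs xs \<phi> \<in> formulas L B (V - set xs)"
proof -
  assume \<phi>: "\<phi> \<in> formulas L B V"
  have "wf_fm L (exs xs \<phi>) = wf_fm L \<phi>" "params (exs xs \<phi>) = params \<phi>"
    by (induction xs) (auto simp: exs_def)
  then show ?thesis using \<phi> by (auto simp: formulas_def free_vars_exs)
qed

text \<open>Undoes \<open>exs\<close> when the number of quantifiers is known, so that a formula can
  be recovered from a sentence and a number.\<close>

fun strip :: "nat \<Rightarrow> ('f, 'r, 'a) fm \<Rightarrow> ('f, 'r, 'a) fm" where
  "strip (Suc n) (Exi i \<phi>) = strip n \<phi>"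
| "strip _ \<phi> = \<phi>"

lemma strip_exs: "strip (length xs) (exs xs \<phi>) = \<phi>"
proof (induction xs)
  case Nil
  then show ?case by (cases \<phi>) (auto simp: exs_def)
qed (auto simp: exs_def)

section \<open>Cardinalities\<close>

lemma card_of_lists_bound:
  assumes "Cinfinite r" "|A| \<le>o r"
  shows "|lists A| \<le>o r"
proof -
  have len: "|{xs. set xs \<subseteq> A \<and> length xs = n}| \<le>o r" for n
  proof (induction n)
    case 0
    have "{xs. set xs \<subseteq> A \<and> length xs = 0} = {[]}" by auto
    then show ?case
      using assms(1) by (auto simp: cinfinite_def intro!: Card_order_singl_ordLeq)
  next
    case (Suc n)
    have "{xs. set xs \<subseteq> A \<and> length xs = Suc n} =
        (\<lambda>(x, xs). x # xs) ` (A \<times> {xs. set xs \<subseteq> A \<and> length xs = n})"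
      by (auto simp: length_Suc_conv image_iff)
    moreover have "|A \<times> {xs. set xs \<subseteq> A \<and> length xs = n}| \<le>o r"
      using assms Suc by (auto intro!: card_of_Times_ordLeq_infinite_Field simp: cinfinite_def)
    ultimately show ?case using ordLeq_transitive[OF card_of_image] by simp
  qed
  have "lists A = (\<Union>n\<in>UNIV. {xs. set xs \<subseteq> A \<and> length xs = n})" by auto
  moreover have "|UNIV :: nat set| \<le>o r"
    using assms(1) by (rule ordIso_ordLeq_trans[OF card_of_nat natLeq_ordLeq_cinfinite])
  ultimately show ?thesis
    using UNION_Cinfinite_bound[of UNIV r "\<lambda>n. {xs. set xs \<subseteq> A \<and> length xs = n}"] len assms(1)
    by (simp only:) blast
qed

lemma card_of_nat_bound: "Cinfinite r \<Longrightarrow> |X :: nat set| \<le>o r"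
  by (rule ordLeq_transitive[OF card_of_mono1[OF subset_UNIV]
        ordIso_ordLeq_trans[OF card_of_nat natLeq_ordLeq_cinfinite]])

lemma card_of_Times_bound: "Cinfinite r \<Longrightarrow> |A| \<le>o r \<Longrightarrow> |B| \<le>o r \<Longrightarrow> |A \<times> B| \<le>o r"
  by (auto intro!: card_of_Times_ordLeq_infinite_Field simp: cinfinite_def)

lemma card_of_image_bound: "|A| \<le>o r \<Longrightarrow> |f ` A| \<le>o r"
  by (rule ordLeq_transitive[OF card_of_image])

lemma card_of_subset_image_bound: "X \<subseteq> f ` A \<Longrightarrow> |A| \<le>o r \<Longrightarrow> |X| \<le>o r"
  by (rule ordLeq_transitive[OF card_of_mono1 card_of_image_bound])

text \<open>Completeness puts each sentence or its negation into \<open>T\<close>. A parameter-free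
  formula is recovered by \<open>strip\<close> from its existential closure, and a formula over
  \<open>B\<close> by \<open>concretize\<close> from a list over \<open>B\<close> and a
  parameter-free formula.\<close>

lemma card_of_formulas:
  fixes L :: "('f, 'r) language" and T :: "('f, 'r, 'a) fm set"
  assumes T: "complete_theory L T" and r: "Cinfinite r" and "|T| \<le>o r" "|B| \<le>o r"
  shows "|formulas L B V :: ('f, 'r, 'a) fm set| \<le>o r"
proof -
  let ?F0 = "formulas L {} UNIV :: ('f, 'r, 'a) fm set"
  let ?S = "formulas L {} {} :: ('f, 'r, 'a) fm set"
  \<comment> \<open>The \<open>case\<close> deletes a leading negation; its unspecified values
    elsewhere can only enlarge the upper bound.\<close>
  have "\<phi> \<in> T \<union> (\<lambda>\<psi>. case \<psi> of Neg \<chi> \<Rightarrow> \<chi>) ` T" if "\<phi> \<in> ?S" for \<phi>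
  proof (cases "\<phi> \<in> T")
    case False
    then have "Neg \<phi> \<in> T" using T that by (auto simp: complete_theory_def)
    then show ?thesis by force
  qed simp
  then have "?S \<subseteq> T \<union> (\<lambda>\<psi>. case \<psi> of Neg \<chi> \<Rightarrow> \<chi>) ` T" by blast
  moreover have "|T \<union> (\<lambda>\<psi>. case \<psi> of Neg \<chi> \<Rightarrow> \<chi>) ` T| \<le>o r"
    using assms by (intro Un_Cinfinite_bound card_of_image_bound) auto
  ultimately have S: "|?S| \<le>o r" by (rule ordLeq_transitive[OF card_of_mono1])
  have "?F0 \<subseteq> (\<lambda>(n, \<psi>). strip n \<psi>) ` (UNIV \<times> ?S)"
  proof
    fix \<phi> assume \<phi>: "\<phi> \<in> ?F0"
    obtain xs where xs: "set xs = free_vars \<phi>" using finite_list[OF finite_free_vars[of \<phi>]] by blast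
    have "exs xs \<phi> \<in> ?S"
      using exs_formulas[of \<phi> L "{}" "free_vars \<phi>" xs] \<phi> xs by (auto simp: formulas_def)
    then show "\<phi> \<in> (\<lambda>(n, \<psi>). strip n \<psi>) ` (UNIV \<times> ?S)"
      using strip_exs[of xs \<phi>] by (auto intro!: image_eqI[of _ _ "(length xs, exs xs \<phi>)"])
  qed
  then have F0: "|?F0| \<le>o r"
    by (rule card_of_subset_image_bound) (intro card_of_Times_bound r S card_of_nat_bound)
  have "formulas L B V \<subseteq> (\<lambda>(xs, \<psi>). concretize xs \<psi>) ` (lists B \<times> ?F0)"
  proof
    fix \<phi> assume \<phi>: "\<phi> \<in> formulas L B V"
    obtain h xs where hxs: "set xs = params \<phi>" "\<And>a. a \<in> params \<phi> \<Longrightarrow> xs ! h a = a"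
      using params_index by metis
    have "concretize xs (abstract h \<phi>) = \<phi>" by (rule concretize_abstract[OF hxs(2)])
    moreover have "xs \<in> lists B" using \<phi> hxs(1) by (auto simp: formulas_def)
    ultimately show "\<phi> \<in> (\<lambda>(xs, \<psi>). concretize xs \<psi>) ` (lists B \<times> ?F0)"
      using abstract_formulas[OF \<phi>, of h] by (intro image_eqI[of _ _ "(xs, abstract h \<phi>)"]) auto
  qed
  then show ?thesis
    by (rule card_of_subset_image_bound) (intro card_of_Times_bound card_of_lists_bound r F0 assms)
qed

lemma card_of_Pow_mono:
  assumes "|X| \<le>o |Y|"
  shows "|Pow X| \<le>o |Pow Y|"
proof -
  obtain f where "inj_on f X" "f ` X \<subseteq> Y" using assms card_of_ordLeq[of X Y] by blast
  then have "inj_on (image f) (Pow X)" "image f ` Pow X \<subseteq> Pow Y"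
    by (auto simp: inj_on_image_Pow)
  then show ?thesis using card_of_ordLeq[of "Pow X" "Pow Y"] by blast
qed

lemma card_of_Pow_ctwo: "|Pow (Field r)| =o ctwo ^c r"
  using card_of_Pow_Func[of "Field r"] by (simp add: cexp_def ctwo_def Field_card_of)

lemma card_of_Pow_bound:
  assumes "|X| \<le>o r" "Card_order r"
  shows "|Pow X| \<le>o ctwo ^c r"
proof -
  have "|X| \<le>o |Field r|"
    using assms ordLeq_ordIso_trans ordIso_symmetric[OF card_of_Field_ordIso] by blast
  then show ?thesis
    using ordLeq_ordIso_trans[OF card_of_Pow_mono card_of_Pow_ctwo] by blast
qed

section \<open>Definable relations and saturation\<close>

locale fo_structure =
  fixes L :: "('f, 'r) language" and M :: "('f, 'r, 'a) struct"
begin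

text \<open>Predicates of valuations stand in for formulas, so that closure properties, in
  particular substitution, can be proved semantically and without variable capture.\<close>

definition definable :: "'a set \<Rightarrow> ((nat \<Rightarrow> 'a) \<Rightarrow> bool) \<Rightarrow> bool" where
  "definable B R \<longleftrightarrow> (\<exists>\<phi>\<in>formulas L B UNIV. \<forall>v. sat M v \<phi> \<longleftrightarrow> R v)"

lemma definableI: "\<phi> \<in> formulas L B UNIV \<Longrightarrow> (\<And>v. sat M v \<phi> \<longleftrightarrow> R v) \<Longrightarrow> definable B R"
  unfolding definable_def by blast

lemma definableE:
  assumes "definable B R"
  obtains \<phi> where "\<phi> \<in> formulas L B UNIV" "\<And>v. sat M v \<phi> \<longleftrightarrow> R v"
  using assms unfolding definable_def by blast

lemma definable_mono: "definable B R \<Longrightarrow> B \<subseteq> B' \<Longrightarrow> definable B' R"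
  unfolding definable_def formulas_def by blast

lemma definable_neg: "definable B R \<Longrightarrow> definable B (\<lambda>v. \<not> R v)"
  by (elim definableE, rule definableI[of "Neg _"]) (auto simp: formulas_def)

lemma definable_conj: "definable B R \<Longrightarrow> definable B S \<Longrightarrow> definable B (\<lambda>v. R v \<and> S v)"
proof (elim definableE)
  fix \<phi> \<psi>
  assume "\<phi> \<in> formulas L B UNIV" "\<And>v. sat M v \<phi> \<longleftrightarrow> R v"
    and "\<psi> \<in> formulas L B UNIV" "\<And>v. sat M v \<psi> \<longleftrightarrow> S v"
  then show ?thesis by (intro definableI[of "Conj \<phi> \<psi>"]) (auto simp: formulas_def)
qed

lemma definable_iff: "definable B R \<Longrightarrow> definable B S \<Longrightarrow> definable B (\<lambda>v. R v = S v)"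
proof -
  assume *: "definable B R" "definable B S"
  have "definable B (\<lambda>v. \<not> (R v \<and> \<not> S v) \<and> \<not> (S v \<and> \<not> R v))"
    by (intro definable_conj definable_neg *)
  moreover have "(\<lambda>v. \<not> (R v \<and> \<not> S v) \<and> \<not> (S v \<and> \<not> R v)) = (\<lambda>v. R v = S v)" by auto
  ultimately show ?thesis by simp
qed

lemma definable_ex: "definable B R \<Longrightarrow> definable B (\<lambda>v. \<exists>a. R (v(i := a)))"
  by (elim definableE, rule definableI[of "Exi i _"]) (auto simp: formulas_def)

lemma definable_eq_var: "definable B (\<lambda>v. v i = v j)"
  by (rule definableI[of "Equal (Var i) (Var j)"]) (auto simp: formulas_def)

lemma definable_eq_const: "a \<in> B \<Longrightarrow> definable B (\<lambda>v. v i = a)"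
  by (rule definableI[of "Equal (Var i) (Par a)"]) (auto simp: formulas_def)

lemma definable_True: "definable B (\<lambda>v. True)"
  using definable_eq_var[of B 0 0] by simp

lemma definable_ball:
  "finite I \<Longrightarrow> (\<And>i. i \<in> I \<Longrightarrow> definable B (R i)) \<Longrightarrow> definable B (\<lambda>v. \<forall>i\<in>I. R i v)"
  by (induction I rule: finite_induct) (auto simp: definable_True intro: definable_conj)

lemma definable_subst_var: "definable B R \<Longrightarrow> definable B (\<lambda>v. R (v(i := v j)))"
proof (cases "i = j")
  case False
  assume "definable B R"
  \<comment> \<open>Substituting \<open>j\<close> for \<open>i\<close> is expressed by quantifying
    \<open>i\<close> and equating it with \<open>j\<close>, which is correct because
    \<open>i\<close> and \<open>j\<close> are distinct.\<close>
  then have "definable B (\<lambda>v. \<exists>a. (v(i := a)) i = (v(i := a)) j \<and> R (v(i := a)))"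
    using definable_ex[OF definable_conj[OF definable_eq_var[of B i j]], of R i] by simp
  moreover have "(\<lambda>v. \<exists>a. (v(i := a)) i = (v(i := a)) j \<and> R (v(i := a))) = (\<lambda>v. R (v(i := v j)))"
    using False by (auto simp: fun_eq_iff)
  ultimately show ?thesis by simp
qed simp

lemma definable_subst_const: "definable B R \<Longrightarrow> a \<in> B \<Longrightarrow> definable B (\<lambda>v. R (v(i := a)))"
  using definable_ex[OF definable_conj[OF definable_eq_const[of a B i]], of R i] by simp

lemma definable_subst_consts:
  "definable B R \<Longrightarrow> definable (B \<union> v ` {..<n}) (\<lambda>u. R (\<lambda>i. if i < n then v i else u i))"
proof (induction n)
  case (Suc n)
  let ?S = "\<lambda>u. R (\<lambda>i. if i < n then v i else u i)"
  have "definable (B \<union> v ` {..<Suc n}) ?S"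
    by (rule definable_mono[OF Suc.IH[OF Suc.prems]]) auto
  then have "definable (B \<union> v ` {..<Suc n}) (\<lambda>u. ?S (u(n := v n)))"
    by (rule definable_subst_const) auto
  moreover have "(\<lambda>i. if i < n then v i else (u(n := v n)) i) = (\<lambda>i. if i < Suc n then v i else u i)" for u
    by (auto simp: fun_eq_iff less_Suc_eq)
  ultimately show ?case by simp
qed simp

lemma definable_rename: "definable B R \<Longrightarrow> inj f \<Longrightarrow> definable B (\<lambda>v. R (v \<circ> f))"
proof (elim definableE)
  fix \<phi> assume \<phi>: "\<phi> \<in> formulas L B UNIV" "\<And>v. sat M v \<phi> \<longleftrightarrow> R v" and "inj f"
  show ?thesis
  proof (rule definableI)
    show "subst_fm (\<lambda>i. Var (f i)) Par f \<phi> \<in> formulas L B UNIV"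
      using \<phi>(1) params_subst_fm[of "\<lambda>i. Var (f i)" B \<phi> Par f]
      by (auto simp: formulas_def intro!: wf_subst_fm)
    show "sat M v (subst_fm (\<lambda>i. Var (f i)) Par f \<phi>) \<longleftrightarrow> R (v \<circ> f)" for v
      using sat_subst_fm[OF \<open>inj f\<close>, of "\<lambda>i. Var (f i)" \<phi> M v Par] \<phi>(2) by (auto simp: comp_def)
  qed
qed

lemma sat_one_variable: "\<phi> \<in> formulas L B {0} \<Longrightarrow> v 0 = a \<Longrightarrow> sat M v \<phi> = sat M (\<lambda>_. a) \<phi>"
  by (rule sat_cong) (auto simp: formulas_def)

lemma definable_sat: "\<phi> \<in> formulas L B V \<Longrightarrow> definable B (\<lambda>v. sat M v \<phi>)"
  by (rule definableI[of \<phi>]) (auto simp: formulas_def)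

lemma definable_sat_at: "\<phi> \<in> formulas L B {0} \<Longrightarrow> definable B (\<lambda>v. sat M (\<lambda>_. v i) \<phi>)"
proof -
  assume \<phi>: "\<phi> \<in> formulas L B {0}"
  have "sat M (v(0 := v i)) \<phi> = sat M (\<lambda>_. v i) \<phi>" for v by (rule sat_one_variable[OF \<phi>]) simp
  then show ?thesis using definable_subst_var[OF definable_sat[OF \<phi>], of 0 i] by (simp only:)
qed

text \<open>Both claims come from quantifying all free variables other than 0. The second turns a
  semantic predicate of \<open>v 0\<close> into a formula of the kind from which types are
  built.\<close>

lemma definable_ex_others: "definable B R \<Longrightarrow> definable B (\<lambda>v. \<exists>w. w 0 = v 0 \<and> R w)"
  and definable_one_variable:
    "definable B (\<lambda>v. S (v 0)) \<Longrightarrow> \<exists>\<phi>\<in>formulas L B {0}. \<forall>v. sat M v \<phi> \<longleftrightarrow> S (v 0)"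
proof -
  have *: "\<exists>\<psi>\<in>formulas L B {0}. \<forall>v. sat M v \<psi> \<longleftrightarrow> R' v"
    if R: "definable B R" and R': "\<And>v. R' v \<longleftrightarrow> (\<exists>w. w 0 = v 0 \<and> R w)" for R R'
  proof -
    obtain \<phi> where \<phi>: "\<phi> \<in> formulas L B UNIV" "\<And>v. sat M v \<phi> \<longleftrightarrow> R v"
      using R unfolding definable_def by blast
    obtain xs where xs: "set xs = free_vars \<phi> - {0}"
      using finite_list[of "free_vars \<phi> - {0}"] finite_free_vars by blast
    have "exs xs \<phi> \<in> formulas L B {0}"
      using exs_formulas[of \<phi> L B "free_vars \<phi>" xs] \<phi>(1) xs by (auto simp: formulas_def)
    moreover have "sat M v (exs xs \<phi>) \<longleftrightarrow> R' v" for v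
      unfolding R'
    proof
      assume "\<exists>w. w 0 = v 0 \<and> R w"
      then obtain w where w: "w 0 = v 0" "sat M w \<phi>" using \<phi>(2) by blast
      \<comment> \<open>The valuation \<open>w\<close> is kept only at the quantified variables,
        since \<open>exs\<close> cannot alter \<open>v\<close> elsewhere.\<close>
      then have "sat M (\<lambda>i. if i \<in> set xs then w i else v i) \<phi>"
        by (subst sat_cong[where w = w]) (use xs in auto)
      then show "sat M v (exs xs \<phi>)"
        unfolding sat_exs by (intro exI[of _ "\<lambda>i. if i \<in> set xs then w i else v i"]) simp
    qed (use \<phi>(2) xs in \<open>auto simp: sat_exs\<close>)
    ultimately show ?thesis by blast
  qed
  show "definable B (\<lambda>v. \<exists>w. w 0 = v 0 \<and> R w)" if R: "definable B R"
  proof -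
    obtain \<psi> where \<psi>: "\<psi> \<in> formulas L B {0}" "\<And>v. sat M v \<psi> \<longleftrightarrow> (\<exists>w. w 0 = v 0 \<and> R w)"
      using *[OF R refl] by blast
    show ?thesis using definable_sat[OF \<psi>(1)] \<psi>(2) by simp
  qed
  show "\<exists>\<phi>\<in>formulas L B {0}. \<forall>v. sat M v \<phi> \<longleftrightarrow> S (v 0)" if S: "definable B (\<lambda>v. S (v 0))"
    by (rule *[OF S]) (metis (mono_tags))
qed

lemma definable_instance:
  assumes \<phi>: "\<phi> \<in> formulas L {} UNIV"
  shows "definable (range c) (\<lambda>u. sat M (c(0 := u 0)) \<phi>)"
proof -
  obtain n where n: "free_vars \<phi> \<subseteq> {..<n}" "0 < n"
    using finite_free_vars[of \<phi>] finite_nat_bounded[of "insert 0 (free_vars \<phi>)"] by auto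
  \<comment> \<open>The fresh variable \<open>n\<close> holds the argument while all variables below
    \<open>n\<close> are filled with constants from \<open>c\<close>; \<open>?R\<close> then moves
    it to the object variable 0.\<close>
  let ?R = "\<lambda>v. sat M (v(0 := v n)) \<phi>"
  let ?w = "\<lambda>u i. if i < n then c i else (u(n := u 0)) i"
  have "definable ({} \<union> c ` {..<n}) (\<lambda>u. ?R (?w u))"
    by (rule definable_subst_var[OF definable_subst_consts[OF definable_subst_var[OF definable_sat[OF \<phi>]]]])
  moreover have "?R (?w u) = sat M (c(0 := u 0)) \<phi>" for u
    by (rule sat_cong) (use n in auto)
  ultimately have "definable ({} \<union> c ` {..<n}) (\<lambda>u. sat M (c(0 := u 0)) \<phi>)" by (simp only:)
  then show ?thesis by (rule definable_mono) auto
qed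

definition same_type :: "'a set \<Rightarrow> 'a \<Rightarrow> 'a \<Rightarrow> bool" where
  "same_type B x y \<longleftrightarrow> (\<forall>\<phi>\<in>formulas L B {0}. sat M (\<lambda>_. x) \<phi> \<longleftrightarrow> sat M (\<lambda>_. y) \<phi>)"

lemma same_type_definable:
  assumes "same_type B x y" "definable B (\<lambda>v. S (v 0))"
  shows "S x \<longleftrightarrow> S y"
proof -
  obtain \<phi> where \<phi>: "\<phi> \<in> formulas L B {0}" "\<forall>v. sat M v \<phi> \<longleftrightarrow> S (v 0)"
    using definable_one_variable[OF assms(2)] by (rule bexE)
  show ?thesis
    using assms(1) \<phi>(1) \<phi>(2)[rule_format, of "\<lambda>_. x"] \<phi>(2)[rule_format, of "\<lambda>_. y"]
    unfolding same_type_def by simp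
qed

end

section \<open>Saturation in several variables\<close>

locale saturated_structure = fo_structure L M
  for L :: "('f, 'r) language" and M :: "('f, 'r, 'a) struct" +
  fixes \<kappa> :: "'k rel"
  assumes inaccessible: "strongly_inaccessible \<kappa>"
    and saturated: "saturated L \<kappa> M"
begin

abbreviation small :: "'b set \<Rightarrow> bool" where
  "small X \<equiv> |X| <o \<kappa>"

lemma Cinfinite: "Cinfinite \<kappa>"
  using inaccessible cinfinite_mono[OF ordLess_imp_ordLeq natLeq_cinfinite]
  unfolding strongly_inaccessible_def by blast

lemma small_Un: "small X \<Longrightarrow> small Y \<Longrightarrow> small (X \<union> Y)"
  using Un_Cinfinite_bound_strict Cinfinite by blast

lemma small_finite: "finite X \<Longrightarrow> small X"
  using inaccessible finite_iff_ordLess_natLeq ordLess_transitive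
  unfolding strongly_inaccessible_def by blast

lemma small_image: "small X \<Longrightarrow> small (f ` X)"
  by (rule ordLeq_ordLess_trans[OF card_of_image])

text \<open>Strong inaccessibility is phrased for subsets of \<open>Field \<kappa>\<close>, so the
  field of \<open>r\<close> is first embedded there.\<close>

lemma small_ctwo_power:
  assumes "Card_order r" "r <o \<kappa>"
  shows "ctwo ^c r <o \<kappa>"
proof -
  have r: "|Field r| =o r" by (rule card_of_Field_ordIso[OF assms(1)])
  have small: "|Field r| <o \<kappa>" by (rule ordIso_ordLess_trans[OF r assms(2)])
  have "Card_order \<kappa>" using Cinfinite by blast
  then have "|Field r| \<le>o |Field \<kappa>|"
    using ordLess_imp_ordLeq[OF small] ordLeq_ordIso_trans ordIso_symmetric[OF card_of_Field_ordIso]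
    by blast
  then obtain f where f: "inj_on f (Field r)" "f ` Field r \<subseteq> Field \<kappa>"
    using card_of_ordLeq[of "Field r" "Field \<kappa>"] by blast
  have "|Pow (f ` Field r)| <o \<kappa>"
    using inaccessible f(2) small_image[OF small] unfolding strongly_inaccessible_def by blast
  moreover have "|Field r| \<le>o |f ` Field r|"
    using f(1) card_of_ordLeq[of "Field r" "f ` Field r"] by blast
  ultimately have "|Pow (Field r)| <o \<kappa>"
    using card_of_Pow_mono ordLeq_ordLess_trans by blast
  then show ?thesis by (rule ordIso_ordLess_trans[OF ordIso_symmetric[OF card_of_Pow_ctwo]])
qed

lemma saturation_one_variable:
  assumes "small B" and def: "\<And>R. R \<in> \<R> \<Longrightarrow> definable B (\<lambda>v. R (v 0))"
    and fin: "\<And>F. finite F \<Longrightarrow> F \<subseteq> \<R> \<Longrightarrow> \<exists>a. \<forall>R\<in>F. R a"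
  shows "\<exists>a. \<forall>R\<in>\<R>. R a"
proof -
  define \<Phi> where "\<Phi> R = (SOME \<phi>. \<phi> \<in> formulas L B {0} \<and> (\<forall>v. sat M v \<phi> \<longleftrightarrow> R (v 0)))" for R
  have \<Phi>: "\<Phi> R \<in> formulas L B {0} \<and> (\<forall>v. sat M v (\<Phi> R) \<longleftrightarrow> R (v 0))" if "R \<in> \<R>" for R
    unfolding \<Phi>_def by (rule someI_ex) (use definable_one_variable[OF def[OF that]] in blast)
  have "type_over L M B (\<Phi> ` \<R>)"
    unfolding type_over_def
  proof (intro conjI allI impI)
    show "\<Phi> ` \<R> \<subseteq> formulas L B {0}" using \<Phi> by blast
    fix q assume "q \<subseteq> \<Phi> ` \<R>" "finite q"
    then obtain F where F: "F \<subseteq> \<R>" "finite F" "q = \<Phi> ` F" using finite_subset_image by metis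
    then obtain a where "\<forall>R\<in>F. R a" using fin by blast
    then have "\<forall>\<phi>\<in>q. sat M (\<lambda>_. a) \<phi>" using F \<Phi> by blast
    then show "\<exists>a. \<forall>\<phi>\<in>q. sat M (\<lambda>_. a) \<phi>" by blast
  qed
  then have "realizations M (\<Phi> ` \<R>) \<noteq> {}"
    using saturated \<open>small B\<close> unfolding saturated_def by blast
  then show ?thesis using \<Phi> unfolding realizations_def by blast
qed

text \<open>Induction on the number of variables. The last variable is eliminated by requiring that
  each finite part of \<open>\<R>\<close> be solvable in it; once the first \<open>n\<close> values
  are fixed, they become parameters of a type in the last variable.\<close>

lemma saturation:
  assumes "small B" and "\<And>R. R \<in> \<R> \<Longrightarrow> definable B R"
    and "\<And>R v w. R \<in> \<R> \<Longrightarrow> (\<And>i. i < n \<Longrightarrow> v i = w i) \<Longrightarrow> R v = R w"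
    and "\<And>F. finite F \<Longrightarrow> F \<subseteq> \<R> \<Longrightarrow> \<exists>v. \<forall>R\<in>F. R v"
  shows "\<exists>v. \<forall>R\<in>\<R>. R v"
  using assms(2-)
proof (induction n arbitrary: \<R>)
  case 0
  have "R v" if R: "R \<in> \<R>" for R v
  proof -
    obtain w where "R w" using 0(3)[of "{R}"] R by auto
    then show ?thesis using 0(2)[OF R, of v w] by simp
  qed
  then show ?case by blast
next
  case (Suc n)
  \<comment> \<open>Finite sets are needed as indices, because one value of the variable
    \<open>n\<close> must satisfy all of \<open>F\<close> at once.\<close>
  define \<Psi> where "\<Psi> F = (\<lambda>v. \<exists>a. \<forall>R\<in>F. R (v(n := a)))" for F :: "((nat \<Rightarrow> 'a) \<Rightarrow> bool) set"
  have "\<exists>v. \<forall>R\<in>\<Psi> ` {F. finite F \<and> F \<subseteq> \<R>}. R v"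
  proof (rule Suc.IH)
    fix R assume "R \<in> \<Psi> ` {F. finite F \<and> F \<subseteq> \<R>}"
    then obtain F where F: "R = \<Psi> F" "finite F" "F \<subseteq> \<R>" by blast
    then have "definable B (\<lambda>v. \<forall>R\<in>F. R v)" using Suc.prems(1) by (intro definable_ball) auto
    then show "definable B R" using F(1) definable_ex[of B _ n] unfolding \<Psi>_def by simp
  next
    fix R and v w :: "nat \<Rightarrow> 'a"
    assume "R \<in> \<Psi> ` {F. finite F \<and> F \<subseteq> \<R>}" and vw: "\<And>i. i < n \<Longrightarrow> v i = w i"
    then obtain F where F: "R = \<Psi> F" "finite F" "F \<subseteq> \<R>" by blast
    have "R' (v(n := a)) = R' (w(n := a))" if "R' \<in> F" for R' a
      by (rule Suc.prems(2)) (use that F vw in \<open>auto simp: less_Suc_eq\<close>)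
    then have "(\<forall>R'\<in>F. R' (v(n := a))) = (\<forall>R'\<in>F. R' (w(n := a)))" for a
      by (intro ball_cong refl)
    then show "R v = R w" unfolding F(1) \<Psi>_def by (simp only:)
  next
    fix X assume X: "finite X" "X \<subseteq> \<Psi> ` {F. finite F \<and> F \<subseteq> \<R>}"
    obtain Y where Y: "Y \<subseteq> {F. finite F \<and> F \<subseteq> \<R>}" "finite Y" "X = \<Psi> ` Y"
      using finite_subset_image[OF X] by blast
    then obtain v where v: "\<forall>R\<in>\<Union>Y. R v" using Suc.prems(3)[of "\<Union>Y"] by blast
    have "\<Psi> F v" if "F \<in> Y" for F
      unfolding \<Psi>_def using v that by (intro exI[of _ "v n"]) auto
    then show "\<exists>v. \<forall>R\<in>X. R v" using Y(3) by blast
  qed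
  then obtain v where v: "\<And>F. finite F \<Longrightarrow> F \<subseteq> \<R> \<Longrightarrow> \<Psi> F v" by blast
  have "\<exists>a. \<forall>S\<in>(\<lambda>R a. R (v(n := a))) ` \<R>. S a"
  proof (rule saturation_one_variable)
    show "small (B \<union> v ` {..<n})" by (intro small_Un \<open>small B\<close> small_finite) auto
    fix S assume "S \<in> (\<lambda>R a. R (v(n := a))) ` \<R>"
    then obtain R where R: "R \<in> \<R>" "S = (\<lambda>a. R (v(n := a)))" by blast
    have "definable (B \<union> v ` {..<n}) (\<lambda>u. R (\<lambda>i. if i < n then v i else (u(n := u 0)) i))"
      by (rule definable_subst_var[OF definable_subst_consts[OF Suc.prems(1)[OF R(1)]]])
    moreover have "R (\<lambda>i. if i < n then v i else (u(n := u 0)) i) = S (u 0)" for u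
      unfolding R(2) by (rule Suc.prems(2)[OF R(1)]) auto
    ultimately show "definable (B \<union> v ` {..<n}) (\<lambda>u. S (u 0))" by simp
  next
    fix F assume F: "finite F" "F \<subseteq> (\<lambda>R a. R (v(n := a))) ` \<R>"
    obtain Y where Y: "Y \<subseteq> \<R>" "finite Y" "F = (\<lambda>R a. R (v(n := a))) ` Y"
      using finite_subset_image[OF F] by blast
    then show "\<exists>a. \<forall>S\<in>F. S a" using v[OF Y(2,1)] unfolding \<Psi>_def by blast
  qed
  then obtain a where "\<forall>R\<in>\<R>. R (v(n := a))" by auto
  then show ?case by (rule exI[of _ "v(n := a)"])
qed

end

section \<open>Dependence\<close>

text \<open>Ramsey's theorem is applied once for each size up to \<open>n\<close>, each time inside
  the infinite set obtained before.\<close>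

lemma homogeneous_subset:
  fixes col :: "nat set \<Rightarrow> 'c"
  assumes "infinite Z" and fin: "\<And>m. finite (S m)"
    and col: "\<And>X. finite X \<Longrightarrow> col X \<in> S (card X)"
  shows "\<exists>Y\<subseteq>Z. infinite Y \<and>
    (\<forall>X X'. X \<subseteq> Y \<and> X' \<subseteq> Y \<and> finite X \<and> finite X' \<and> card X = card X' \<and> card X \<le> n \<longrightarrow> col X = col X')"
proof (induction n)
  case 0
  show ?case using \<open>infinite Z\<close> by (intro exI[of _ Z]) auto
next
  case (Suc n)
  then obtain Y where Y: "Y \<subseteq> Z" "infinite Y"
    "\<forall>X X'. X \<subseteq> Y \<and> X' \<subseteq> Y \<and> finite X \<and> finite X' \<and> card X = card X' \<and> card X \<le> n \<longrightarrow> col X = col X'"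
    by (elim exE conjE)
  \<comment> \<open>The colours are numbered by \<open>h\<close>, as \<open>Ramsey\<close> expects
    colours below a natural number.\<close>
  obtain h and s :: nat where h: "bij_betw h (S (Suc n)) {..<s}"
    using ex_bij_betw_finite_nat[OF fin] by (metis atLeast0LessThan)
  have "\<forall>X. X \<subseteq> Y \<and> finite X \<and> card X = Suc n \<longrightarrow> h (col X) < s"
    using col bij_betwE[OF h] by (metis lessThan_iff)
  then obtain Y' t where Y': "Y' \<subseteq> Y" "infinite Y'"
    "\<And>X. X \<subseteq> Y' \<and> finite X \<and> card X = Suc n \<Longrightarrow> h (col X) = t"
    using Ramsey[OF Y(2), of "Suc n" "\<lambda>X. h (col X)" s] by blast
  have "col X = col X'"
    if X: "X \<subseteq> Y'" "X' \<subseteq> Y'" "finite X" "finite X'" "card X = card X'" "card X \<le> Suc n" for X X'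
  proof (cases "card X = Suc n")
    case True
    then have "h (col X) = h (col X')" using Y'(3) X by simp
    then show ?thesis
      using bij_betw_imp_inj_on[OF h] col[OF X(3)] col[OF X(4)] X(5) True by (simp add: inj_on_def)
  next
    case False
    then show ?thesis using X Y'(1) by (intro Y(3)[rule_format]) auto
  qed
  then show ?case using Y(1) Y'(1,2) by (intro exI[of _ Y']) auto
qed

section \<open>Quotients in a type-definable group\<close>

locale type_definable_group = saturated_structure L M \<kappa> + comm_group G
  for L :: "('f, 'r) language" and M :: "('f, 'r, 'a) struct" and \<kappa> :: "'k rel"
    and G :: "'a monoid" (structure) +
  fixes T :: "('f, 'r, 'a) fm set" and A :: "'a set" and p :: "('f, 'r, 'a) fm set"
    and inverse_op :: "'a \<Rightarrow> 'a"
  assumes complete_theory: "complete_theory L T" and dependent: "dependent_theory L T"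
    and small_theory: "|T| <o \<kappa>" and model: "is_model M T"
    and small_A: "|A| <o \<kappa>" and type_p: "type_over L M A p"
    and carrier_eq: "carrier G = realizations M p"
    and definable_mult3: "definable A (\<lambda>v. v 0 \<otimes> v 1 = v 2)"
    and definable_inverse_op: "definable A (\<lambda>v. inverse_op (v 0) = v 1)"
    and definable_one: "definable A (\<lambda>v. v 0 = \<one>)"
    and inverse_op: "\<And>x. x \<in> carrier G \<Longrightarrow> inverse_op x = inv x"
begin

lemma definable_mult: "definable A (\<lambda>v. v i \<otimes> v j = v k)"
proof -
  \<comment> \<open>Three fresh variables receive the values of \<open>i\<close>, \<open>j\<close>
    and \<open>k\<close> in turn, so the substitutions do not interfere even if these indices
    coincide.\<close>
  define N where "N = Suc (i + j + k)"
  have "definable A (\<lambda>v. v N \<otimes> v (Suc N) = v (Suc (Suc N)))"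
    using definable_rename[OF definable_mult3, of "\<lambda>x. x + N"] by (simp add: inj_def)
  from definable_subst_var[OF definable_subst_var[OF definable_subst_var[OF this, of N i],
        of "Suc N" j], of "Suc (Suc N)" k]
  show ?thesis by (simp add: N_def)
qed

lemma p_formulas: "\<phi> \<in> p \<Longrightarrow> \<phi> \<in> formulas L A {0}"
  using type_p unfolding type_over_def by blast

text \<open>Each formula of \<open>\<Delta>\<close> has its own parameter tuple \<open>d k\<close>;
  the object variable is 0.\<close>

definition agree :: "('f, 'r, 'a) fm list \<Rightarrow> (nat \<Rightarrow> nat \<Rightarrow> 'a) \<Rightarrow> 'a \<Rightarrow> 'a \<Rightarrow> bool" where
  "agree \<Delta> d y z \<longleftrightarrow>
     (\<forall>k<length \<Delta>. sat M ((d k)(0 := y)) (\<Delta> ! k) \<longleftrightarrow> sat M ((d k)(0 := z)) (\<Delta> ! k))"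

lemma agree_sym: "agree \<Delta> d y z \<Longrightarrow> agree \<Delta> d z y"
  unfolding agree_def by blast

text \<open>For \<open>q = p\<close> this is \<open>D(\<Delta>, d)\<close> of the outline; for
  finite \<open>q \<subseteq> p\<close> it is a definable superset. The numerator is written
  \<open>u \<otimes> z\<close> to avoid inverses, as the group laws are given only on
  \<open>G\<close>.\<close>

definition quotients ::
    "('f, 'r, 'a) fm set \<Rightarrow> ('f, 'r, 'a) fm list \<Rightarrow> (nat \<Rightarrow> nat \<Rightarrow> 'a) \<Rightarrow> 'a set" where
  "quotients q \<Delta> d = {u \<in> realizations M q.
     \<exists>z\<in>realizations M q. u \<otimes> z \<in> realizations M q \<and> agree \<Delta> d z (u \<otimes> z)}"

definition triple_products ::
    "('f, 'r, 'a) fm set \<Rightarrow> ('f, 'r, 'a) fm list \<Rightarrow> (nat \<Rightarrow> nat \<Rightarrow> 'a) \<Rightarrow> 'a set" where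
  "triple_products q \<Delta> d =
     {x. \<exists>u\<in>quotients q \<Delta> d. \<exists>u'\<in>quotients q \<Delta> d. \<exists>u''\<in>quotients q \<Delta> d. x = u \<otimes> u' \<otimes> u''}"

lemma realizations_antimono: "q \<subseteq> p \<Longrightarrow> carrier G \<subseteq> realizations M q"
  unfolding carrier_eq realizations_def by blast

lemma quotients_antimono: "q \<subseteq> p \<Longrightarrow> quotients p \<Delta> d \<subseteq> quotients q \<Delta> d"
  using realizations_antimono[of q] unfolding quotients_def carrier_eq by blast

lemma quotients_p:
  assumes "y \<in> carrier G" "z \<in> carrier G" "agree \<Delta> d y z"
  shows "y \<otimes> inv z \<in> quotients p \<Delta> d"
proof -
  have "y \<otimes> inv z \<otimes> z = y" using assms by (simp add: m_assoc)
  then show ?thesis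
    using assms agree_sym[OF assms(3)] unfolding quotients_def carrier_eq[symmetric] by force
qed

text \<open>In definable relations, \<open>d k l\<close> is the value of the variable \<open>code k l\<close>; the variables
  below 10 remain for other purposes.\<close>

definition code :: "nat \<Rightarrow> nat \<Rightarrow> nat" where
  "code k l = 10 + prod_encode (k, l)"

lemma inj_code: "inj (code k)"
  by (auto simp: inj_def code_def)

lemma code_neq: "i < 10 \<Longrightarrow> code k l \<noteq> i" "i < 10 \<Longrightarrow> i \<noteq> code k l"
  by (auto simp: code_def)

lemma definable_agree_part:
  assumes "\<phi> \<in> formulas L {} UNIV"
  shows "definable A (\<lambda>v. sat M ((\<lambda>l. v (code k l))(0 := v i)) \<phi>)"
proof -
  have "definable A (\<lambda>v. sat M (v \<circ> code k) \<phi>)"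
    by (rule definable_rename[OF definable_mono[OF definable_sat[OF assms]] inj_code]) simp
  \<comment> \<open>The object variable of \<open>\<phi>\<close> has been renamed to
    \<open>code k 0\<close>, which is where the variable \<open>i\<close> is inserted.\<close>
  from definable_subst_var[OF this, of "code k 0" i]
  have "definable A (\<lambda>v. sat M (v(code k 0 := v i) \<circ> code k) \<phi>)" .
  moreover have "v(code k 0 := v i) \<circ> code k = (\<lambda>l. v (code k l))(0 := v i)" for v :: "nat \<Rightarrow> 'a"
    using inj_code[of k] by (auto simp: fun_eq_iff inj_def)
  ultimately show ?thesis by (simp only:)
qed

text \<open>Finiteness of \<open>q\<close> turns its realizations into a definable set, whereas
  \<open>G\<close> is given only by a type. The tuples are variables here, so definability over
  \<open>A\<close> is uniform in them.\<close>

lemma definable_quotients: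
  assumes "finite q" "q \<subseteq> p" "set \<Delta> \<subseteq> formulas L {} UNIV"
  shows "definable A (\<lambda>v. v 0 \<in> quotients q \<Delta> (\<lambda>k l. v (code k l)))"
proof -
  \<comment> \<open>The variables 1 and 2 hold \<open>z\<close> and
    \<open>u \<otimes> z\<close>.\<close>
  let ?R = "\<lambda>v. v 0 \<otimes> v 1 = v 2 \<and>
    (\<forall>i\<in>{0,1,2}. \<forall>\<phi>\<in>q. sat M (\<lambda>_. v i) \<phi>) \<and>
    (\<forall>k\<in>{..<length \<Delta>}. sat M ((\<lambda>l. v (code k l))(0 := v 1)) (\<Delta> ! k) =
      sat M ((\<lambda>l. v (code k l))(0 := v 2)) (\<Delta> ! k))"
  have "definable A ?R"
    using assms p_formulas
    by (intro definable_conj definable_mult definable_ball definable_iff definable_agree_part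
        definable_sat_at) auto
  then have "definable A (\<lambda>v. \<exists>z. \<exists>y. ?R (v(1 := z, 2 := y)))"
    using definable_ex[OF definable_ex, of A ?R 1 2] by (simp only:)
  moreover have "(\<exists>z. \<exists>y. ?R (v(1 := z, 2 := y))) \<longleftrightarrow> v 0 \<in> quotients q \<Delta> (\<lambda>k l. v (code k l))" for v
    unfolding quotients_def agree_def realizations_def
    by (auto simp: code_neq)
  ultimately show ?thesis by (simp only:)
qed

lemma definable_triple_products:
  assumes "finite q" "q \<subseteq> p" "set \<Delta> \<subseteq> formulas L {} UNIV"
  shows "definable A (\<lambda>v. v 0 \<in> triple_products q \<Delta> (\<lambda>k l. v (code k l)))"
proof -
  let ?D = "\<lambda>v i. v i \<in> quotients q \<Delta> (\<lambda>k l. v (code k l))"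
  \<comment> \<open>The variables 1, 2, 3 hold the factors, and 4 the product of the first
    two.\<close>
  let ?R = "\<lambda>v. ?D v 1 \<and> ?D v 2 \<and> ?D v 3 \<and> v 1 \<otimes> v 2 = v 4 \<and> v 4 \<otimes> v 3 = v 0"
  have D: "definable A (\<lambda>v. ?D v i)" for i
    using definable_subst_var[OF definable_quotients[OF assms], of 0 i] by (simp add: code_neq)
  have "definable A ?R"
    by (intro definable_conj definable_mult D)
  then have "definable A (\<lambda>v. \<exists>a b c s. ?R (v(1 := a, 2 := b, 3 := c, 4 := s)))"
    using definable_ex[OF definable_ex[OF definable_ex[OF definable_ex]], of A ?R 1 2 3 4]
    by (simp only:)
  moreover have "(\<exists>a b c s. ?R (v(1 := a, 2 := b, 3 := c, 4 := s))) \<longleftrightarrow>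
      v 0 \<in> triple_products q \<Delta> (\<lambda>k l. v (code k l))" for v
    unfolding triple_products_def by (auto simp: code_neq) metis+
  ultimately show ?thesis by (simp only:)
qed

section \<open>Independence patterns and finiteness\<close>

text \<open>Complementing \<open>w\<close> turns the pattern into the independence property; the
  parameters from \<open>A\<close> become odd variables whose values are the same for all
  \<open>j\<close>.\<close>

lemma no_independence:
  assumes R: "definable A (\<lambda>v. R (v 0) (\<lambda>k l. v (code k l)))"
    and pattern: "\<And>n. \<exists>D :: nat \<Rightarrow> nat \<Rightarrow> nat \<Rightarrow> 'a. \<forall>w\<subseteq>{..<n}. \<exists>b. \<forall>j<n. R b (D j) \<longleftrightarrow> j \<notin> w"
  shows False
proof -
  obtain \<phi> where \<phi>: "\<phi> \<in> formulas L A UNIV" "\<And>v. sat M v \<phi> \<longleftrightarrow> R (v 0) (\<lambda>k l. v (code k l))"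
    using R unfolding definable_def by blast
  obtain \<phi>' c where \<phi>': "\<phi>' \<in> formulas L {} UNIV"
    "\<forall>v. sat M (\<lambda>k. if even k then v (k div 2) else c k) \<phi>' = sat M v \<phi>"
    using abstract_parameters[OF \<phi>(1), of M] by (elim exE conjE)
  have "has_IP M \<phi>' {0}"
    unfolding has_IP_def
  proof
    fix n
    obtain D :: "nat \<Rightarrow> nat \<Rightarrow> nat \<Rightarrow> 'a" where
      D: "\<And>w. w \<subseteq> {..<n} \<Longrightarrow> \<exists>b. \<forall>j<n. R b (D j) \<longleftrightarrow> j \<notin> w"
      using pattern[of n] by blast
    \<comment> \<open>\<open>?d i\<close> places \<open>D i k l\<close> at the variable
      \<open>code k l\<close>. Its values below 10 are harmless, as \<open>R\<close> reads only the
      coded variables and the variable 0, which is set to \<open>b\<close>.\<close>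
    let ?d = "\<lambda>i m. case prod_decode (m - 10) of (k, l) \<Rightarrow> D i k l"
    let ?b = "\<lambda>i k. if even k then ?d i (k div 2) else c k"
    have "\<exists>a. \<forall>i<n. sat M (\<lambda>k. if k \<in> {0} then a k else ?b i k) \<phi>' \<longleftrightarrow> i \<in> w"
      if w: "w \<subseteq> {..<n}" for w
    proof -
      obtain b where b: "\<And>j. j < n \<Longrightarrow> R b (D j) \<longleftrightarrow> j \<notin> {..<n} - w"
        using D[of "{..<n} - w"] by blast
      have "sat M (\<lambda>k. if k \<in> {0} then b else ?b i k) \<phi>' \<longleftrightarrow> i \<in> w" if "i < n" for i
      proof -
        let ?v = "(?d i)(0 := b)"
        have "(\<lambda>k. if k \<in> {0} then b else ?b i k) = (\<lambda>k. if even k then ?v (k div 2) else c k)"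
          by (auto simp: fun_eq_iff elim!: evenE)
        then have "sat M (\<lambda>k. if k \<in> {0} then b else ?b i k) \<phi>' \<longleftrightarrow>
            R (?v 0) (\<lambda>k l. ?v (code k l))"
          using \<phi>'(2)[rule_format, of ?v] \<phi>(2)[of ?v] by (simp only:)
        also have "(\<lambda>k l. ?v (code k l)) = D i" by (simp add: code_def)
        finally show ?thesis using b[OF that] that by auto
      qed
      then show ?thesis by (intro exI[of _ "\<lambda>_. b"]) blast
    qed
    then show "\<exists>b. \<forall>w\<subseteq>{..<n}. \<exists>a. \<forall>i<n. sat M (\<lambda>k. if k \<in> {0} then a k else b i k) \<phi>' \<longleftrightarrow> i \<in> w"
      by (intro exI[of _ ?b]) blast
  qed
  then show False using dependent model \<phi>'(1) unfolding dependent_theory_def by blast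
qed

text \<open>Ramsey's theorem is applied to sets \<open>X\<close> of indices, coloured by the truth values, for each \<open>x \<in> X\<close>,
  of the formulas \<open>\<Delta>\<close> with parameters \<open>d x\<close> at the product over \<open>X - {x}\<close>.\<close>

lemma even_odd_products_agree:
  fixes a :: "nat \<Rightarrow> 'a" and d :: "nat \<Rightarrow> nat \<Rightarrow> nat \<Rightarrow> 'a"
  assumes a: "\<And>i. a i \<in> carrier G"
  shows "\<exists>s :: nat \<Rightarrow> nat. strict_mono s \<and> (\<forall>w j. w \<subseteq> {..<n} \<longrightarrow> j < n \<longrightarrow> j \<notin> w \<longrightarrow>
      agree \<Delta> (d (s (2 * j))) (finprod G (\<lambda>i. a (s (2 * i))) w) (finprod G (\<lambda>i. a (s (Suc (2 * i)))) w))"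
proof -
  \<comment> \<open>Elements are recorded by their rank in \<open>X\<close>, so that colours of
    different sets of equal size are comparable and come from a finite palette.\<close>
  let ?rank = "\<lambda>X x. card {i \<in> X. i < x}"
  let ?S = "\<lambda>m. Pow ({..<m} \<times> {..<length \<Delta>})"
  let ?sat = "\<lambda>X x k. sat M ((d x k)(0 := finprod G a (X - {x}))) (\<Delta> ! k)"
  define col where "col X = {(?rank X x, k) | x k. x \<in> X \<and> k < length \<Delta> \<and> ?sat X x k}"
    for X :: "nat set"
  have "col X \<in> ?S (card X)" if "finite X" for X
    using that by (auto simp: col_def intro!: psubset_card_mono)
  then have "\<exists>Y\<subseteq>UNIV. infinite Y \<and> (\<forall>X X'. X \<subseteq> Y \<and> X' \<subseteq> Y \<and> finite X \<and> finite X' \<and>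
      card X = card X' \<and> card X \<le> n \<longrightarrow> col X = col X')"
    by (intro homogeneous_subset[where S = ?S]) auto
  then obtain Y where Y: "infinite Y" "\<forall>X X'. X \<subseteq> Y \<and> X' \<subseteq> Y \<and> finite X \<and> finite X' \<and>
      card X = card X' \<and> card X \<le> n \<longrightarrow> col X = col X'"
    by (elim exE conjE)
  have rank_inj: "x = y" if "finite X" "x \<in> X" "y \<in> X" "?rank X x = ?rank X y" for X x and y :: nat
  proof (rule ccontr)
    assume "x \<noteq> y"
    moreover have False if "finite X" "x \<in> X" "?rank X x = ?rank X y" "x < y" for x and y :: nat
    proof -
      have "{i \<in> X. i < x} \<subset> {i \<in> X. i < y}" using that by auto
      then have "?rank X x < ?rank X y" using that(1) by (intro psubset_card_mono) auto
      then show False using that(3) by simp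
    qed
    ultimately show False using that by (metis linorder_neqE_nat)
  qed
  have in_col: "(?rank X x, k) \<in> col X \<longleftrightarrow> ?sat X x k" if "finite X" "x \<in> X" "k < length \<Delta>" for X x k
    unfolding col_def using that rank_inj by auto
  define s where "s = enumerate Y"
  have s: "strict_mono s" "\<And>i. s i \<in> Y"
    unfolding s_def using Y(1) by (auto simp: strict_mono_enumerate enumerate_in_set)
  have s_less: "s i < s j \<longleftrightarrow> i < j" and s_eq: "s i = s j \<longleftrightarrow> i = j" for i j
    using s(1) by (auto simp: strict_mono_less strict_mono_eq)
  have "agree \<Delta> (d (s (2 * j))) (finprod G (\<lambda>i. a (s (2 * i))) w) (finprod G (\<lambda>i. a (s (Suc (2 * i)))) w)"
    if w: "w \<subseteq> {..<n}" "j < n" "j \<notin> w" for w j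
  proof -
    let ?x = "s (2 * j)" and ?E = "(\<lambda>i. s (2 * i)) ` w" and ?O = "(\<lambda>i. s (Suc (2 * i))) ` w"
    have [simp]: "finite w" using w(1) finite_subset by blast
    have x: "?x \<notin> ?E" "?x \<notin> ?O" using w(3) by (auto simp: s_eq) presburger
    have inj: "inj_on (\<lambda>i. s (2 * i)) W" "inj_on (\<lambda>i. s (Suc (2 * i))) W" for W
      by (auto simp: inj_on_def s_eq)
    \<comment> \<open>Since \<open>w\<close> omits \<open>j\<close>, adding \<open>?x\<close> keeps
      the size within the bound \<open>n\<close> of homogeneity.\<close>
    have "w \<subset> {..<n}" using w by blast
    then have "Suc (card w) \<le> n" using psubset_card_mono[of "{..<n}" w] by simp
    then have col: "col (insert ?x ?E) = col (insert ?x ?O)"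
      by (intro Y(2)[rule_format]) (auto simp: s(2) x card_image inj)
    \<comment> \<open>Both \<open>2 * i < 2 * j\<close> and \<open>Suc (2 * i) < 2 * j\<close> mean
      \<open>i < j\<close>, so \<open>?x\<close> has the same rank in both sets.\<close>
    have "{i \<in> insert ?x ?E. i < ?x} = (\<lambda>i. s (2 * i)) ` {i \<in> w. i < j}"
      by (auto simp: s_less)
    moreover have "{i \<in> insert ?x ?O. i < ?x} = (\<lambda>i. s (Suc (2 * i))) ` {i \<in> w. i < j}"
      by (auto simp: s_less)
    ultimately have rank: "?rank (insert ?x ?E) ?x = ?rank (insert ?x ?O) ?x"
      by (simp only: card_image[OF inj(1)] card_image[OF inj(2)])
    have "?sat (insert ?x ?E) ?x k = ?sat (insert ?x ?O) ?x k" if "k < length \<Delta>" for k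
      using in_col[of "insert ?x ?E" ?x k] in_col[of "insert ?x ?O" ?x k] col rank that by simp
    moreover have "insert ?x ?E - {?x} = ?E" "insert ?x ?O - {?x} = ?O" using x by auto
    moreover have "finprod G a ?E = finprod G (\<lambda>i. a (s (2 * i))) w"
      "finprod G a ?O = finprod G (\<lambda>i. a (s (Suc (2 * i)))) w"
      by (rule finprod_reindex; use a inj in auto)+
    ultimately show ?thesis unfolding agree_def by simp
  qed
  then show ?thesis using s(1) by (intro exI[of _ s]) simp
qed

text \<open>Let \<open>b w\<close> be \<open>E w\<close> divided by \<open>O' w\<close>. If
  \<open>j \<notin> w\<close>, the two products agree, so \<open>b w\<close> lies in the set for
  \<open>j\<close>. If \<open>j \<in> w\<close>, let \<open>w'\<close> be \<open>w\<close> without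
  \<open>j\<close>: then \<open>a (s (2 * j))\<close> is the product of \<open>b w\<close>, of
  \<open>O' w'\<close> divided by \<open>E w'\<close>, and of \<open>a (s (Suc (2 * j)))\<close>.
  The last two lie in the set for \<open>j\<close>, so \<open>b w\<close> cannot, by
  \<open>not_triple\<close>.\<close>

lemma no_infinite_sequence:
  fixes a :: "nat \<Rightarrow> 'a" and d :: "nat \<Rightarrow> nat \<Rightarrow> nat \<Rightarrow> 'a"
  assumes q: "finite q" "q \<subseteq> p" and \<Delta>: "set \<Delta> \<subseteq> formulas L {} UNIV"
    and a: "\<And>i. a i \<in> carrier G" and not_triple: "\<And>i. a i \<notin> triple_products q \<Delta> (d i)"
    and quotient: "\<And>i j. i < j \<Longrightarrow> a j \<in> quotients p \<Delta> (d i)"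
  shows False
proof (rule no_independence[OF definable_quotients[OF q \<Delta>]])
  fix n
  obtain s :: "nat \<Rightarrow> nat" where s: "strict_mono s"
    "\<forall>w j. w \<subseteq> {..<n} \<longrightarrow> j < n \<longrightarrow> j \<notin> w \<longrightarrow> agree \<Delta> (d (s (2 * j))) (finprod G (\<lambda>i. a (s (2 * i))) w) (finprod G (\<lambda>i. a (s (Suc (2 * i)))) w)"
    using even_odd_products_agree[of a n \<Delta> d, OF a] by (elim exE conjE)
  define E where "E = finprod G (\<lambda>i. a (s (2 * i)))"
  define O' where "O' = finprod G (\<lambda>i. a (s (Suc (2 * i))))"
  have EO: "E w \<in> carrier G" "O' w \<in> carrier G" for w
    unfolding E_def O'_def using a by auto
  have agree: "agree \<Delta> (d (s (2 * j))) (E w) (O' w)" if "w \<subseteq> {..<n}" "j < n" "j \<notin> w" for w j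
    unfolding E_def O'_def using s(2) that by simp
  have "E w \<otimes> inv O' w \<in> quotients q \<Delta> (d (s (2 * j))) \<longleftrightarrow> j \<notin> w" if w: "w \<subseteq> {..<n}" "j < n" for w j
  proof
    assume "j \<notin> w"
    then show "E w \<otimes> inv O' w \<in> quotients q \<Delta> (d (s (2 * j)))"
      using quotients_antimono[OF q(2)] quotients_p[OF EO agree] w by blast
  next
    assume u: "E w \<otimes> inv O' w \<in> quotients q \<Delta> (d (s (2 * j)))"
    show "j \<notin> w"
    proof
      assume "j \<in> w"
      define w' where "w' = w - {j}"
      have w': "w = insert j w'" "j \<notin> w'" "finite w'" "w' \<subseteq> {..<n}"
        using \<open>j \<in> w\<close> w finite_subset[of w "{..<n}"] by (auto simp: w'_def)
      let ?x = "a (s (2 * j))" and ?y = "a (s (Suc (2 * j)))"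
      have Ew: "E w = ?x \<otimes> E w'" and Ow: "O' w = ?y \<otimes> O' w'"
        unfolding E_def O'_def w'(1) using w' a by auto
      have u': "O' w' \<otimes> inv E w' \<in> quotients q \<Delta> (d (s (2 * j)))"
        using quotients_antimono[OF q(2)] quotients_p[OF EO(2) EO(1) agree_sym[OF agree]] w'(2,4) w(2)
        by blast
      have u'': "?y \<in> quotients q \<Delta> (d (s (2 * j)))"
        using quotients_antimono[OF q(2)] quotient[of "s (2 * j)" "s (Suc (2 * j))"] s(1)
        by (auto simp: strict_mono_less)
      \<comment> \<open>The inverses are generalized to \<open>z\<close> and \<open>t\<close>, which
        makes the rearrangement pure commutativity; they cancel after instantiation.\<close>
      have "(?x \<otimes> E w' \<otimes> z) \<otimes> (O' w' \<otimes> t) \<otimes> ?y = ?x \<otimes> (E w' \<otimes> t) \<otimes> (z \<otimes> (?y \<otimes> O' w'))"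
        if "z \<in> carrier G" "t \<in> carrier G" for z t
        using a EO that by (simp add: m_ac)
      from this[of "inv (?y \<otimes> O' w')" "inv E w'"]
      have "(E w \<otimes> inv O' w) \<otimes> (O' w' \<otimes> inv E w') \<otimes> ?y = ?x"
        unfolding Ew Ow using a EO by simp
      then have "?x \<in> triple_products q \<Delta> (d (s (2 * j)))"
        unfolding triple_products_def using u u' u'' by auto metis
      then show False using not_triple by blast
    qed
  qed
  then show "\<exists>D :: nat \<Rightarrow> nat \<Rightarrow> nat \<Rightarrow> 'a. \<forall>w\<subseteq>{..<n}. \<exists>b. \<forall>j<n. b \<in> quotients q \<Delta> (D j) \<longleftrightarrow> j \<notin> w"
    by (intro exI[of _ "\<lambda>j. d (s (2 * j))"]) blast
qed

text \<open>Otherwise each finite set of tuples has a counterexample \<open>x\<close> together with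
  a tuple that excludes it; adding these tuples one after another yields the sequence ruled out by
  \<open>no_infinite_sequence\<close>.\<close>

lemma finitely_many_parameters:
  assumes q: "finite q" "q \<subseteq> p" and \<Delta>: "set \<Delta> \<subseteq> formulas L {} UNIV"
  shows "\<exists>Ds. finite Ds \<and>
    (\<forall>x\<in>carrier G. (\<forall>d\<in>Ds. x \<in> quotients p \<Delta> d) \<longrightarrow> (\<forall>d. x \<in> triple_products q \<Delta> d))"
proof (rule ccontr)
  assume "\<not> ?thesis"
  then have "\<forall>Ds. finite Ds \<longrightarrow>
    (\<exists>x d. x \<in> carrier G \<and> (\<forall>d\<in>Ds. x \<in> quotients p \<Delta> d) \<and> x \<notin> triple_products q \<Delta> d)"
    by blast
  then obtain x d where xd: "\<And>Ds. finite Ds \<Longrightarrow>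
      x Ds \<in> carrier G \<and> (\<forall>d\<in>Ds. x Ds \<in> quotients p \<Delta> d) \<and> x Ds \<notin> triple_products q \<Delta> (d Ds)"
    by metis
  \<comment> \<open>Every stage contains the tuples chosen at all earlier ones, so later
    counterexamples are quotients for the earlier tuples.\<close>
  define Ds where "Ds = rec_nat {} (\<lambda>_ D. insert (d D) D)"
  have Ds: "Ds 0 = {}" "Ds (Suc n) = insert (d (Ds n)) (Ds n)" for n by (simp_all add: Ds_def)
  have fin: "finite (Ds n)" for n by (induction n) (auto simp: Ds)
  have mono: "d (Ds i) \<in> Ds j" if "i < j" for i j
    using that by (induction j) (auto simp: Ds less_Suc_eq)
  show False
    by (rule no_infinite_sequence[OF q \<Delta>, of "\<lambda>n. x (Ds n)" "\<lambda>n. d (Ds n)"])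
      (use xd fin mono in blast)+
qed

section \<open>The connected component\<close>

text \<open>The set \<open>Q\<close> of the outline, formed with the supersets for finite
  \<open>q\<close> in place of \<open>D(\<Delta>, d)\<close>. Thus every single condition is
  definable, as saturation and invariance over \<open>A\<close> require.\<close>

definition core :: "'a set" where
  "core = {x \<in> carrier G. \<forall>q \<Delta> d. finite q \<longrightarrow> q \<subseteq> p \<longrightarrow> set \<Delta> \<subseteq> formulas L {} UNIV \<longrightarrow>
     x \<in> triple_products q \<Delta> d}"

definition component :: "'a set" where
  "component = generate G core"

lemma core_subset_carrier: "core \<subseteq> carrier G"
  unfolding core_def by blast

lemma subgroup_component: "subgroup component G"
  unfolding component_def by (rule generate_is_subgroup[OF core_subset_carrier])

lemma same_type_carrier: "same_type A x y \<Longrightarrow> x \<in> carrier G \<Longrightarrow> y \<in> carrier G"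
  using p_formulas unfolding carrier_eq realizations_def same_type_def by blast

text \<open>\<open>B\<close> consists of the entries of all tuples provided by
  \<open>finitely_many_parameters\<close>. Equal types over \<open>B\<close> give agreement at these
  tuples, and hence triple products at all tuples.\<close>

lemma quotients_in_core:
  assumes r: "Cinfinite r" and A: "|A| \<le>o r" and T: "|T| \<le>o r"
  shows "\<exists>B. |B| \<le>o r \<and>
    (\<forall>y\<in>carrier G. \<forall>z\<in>carrier G. same_type B y z \<longrightarrow> y \<otimes> inv z \<in> core)"
proof -
  let ?F = "formulas L {} UNIV :: ('f, 'r, 'a) fm set"
  \<comment> \<open>Lists replace finite sets so that the pairs \<open>qs\<close>,
    \<open>\<Delta>\<close> can be counted by \<open>card_of_lists_bound\<close>.\<close>
  define good where "good qs \<Delta> ds \<longleftrightarrow> (\<forall>x\<in>carrier G. (\<forall>d\<in>set ds. x \<in> quotients p \<Delta> d) \<longrightarrow>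
    (\<forall>d. x \<in> triple_products (set qs) \<Delta> d))" for qs \<Delta> ds
  define D where "D qs \<Delta> = (SOME ds. good qs \<Delta> ds)" for qs \<Delta>
  have D: "good qs \<Delta> (D qs \<Delta>)" if qs: "set qs \<subseteq> p" and \<Delta>: "set \<Delta> \<subseteq> ?F" for qs \<Delta>
  proof -
    obtain Ds where "finite Ds" and Ds: "\<forall>x\<in>carrier G. (\<forall>d\<in>Ds. x \<in> quotients p \<Delta> d) \<longrightarrow>
        (\<forall>d. x \<in> triple_products (set qs) \<Delta> d)"
      using finitely_many_parameters[OF finite_set qs \<Delta>] by (elim exE conjE)
    obtain ds where "set ds = Ds" using finite_list[OF \<open>finite Ds\<close>] by blast
    then have "good qs \<Delta> ds" using Ds unfolding good_def by simp
    then show ?thesis unfolding D_def by (rule someI)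
  qed
  \<comment> \<open>\<open>m\<close> selects a tuple of the list, and \<open>k\<close>,
    \<open>l\<close> one of its entries; indices beyond the list add arbitrary elements without
    raising the bound.\<close>
  define B where "B = (\<lambda>((qs, \<Delta>), m, k, l). (D qs \<Delta> ! m) k l) ` ((lists p \<times> lists ?F) \<times> UNIV)"
  have F: "|?F| \<le>o r"
    by (rule card_of_formulas[OF complete_theory r T]) (use r in \<open>auto intro: Card_order_empty\<close>)
  have p: "|p| \<le>o r"
  proof (rule ordLeq_transitive[OF card_of_mono1])
    show "p \<subseteq> formulas L A {0}" using p_formulas by blast
    show "|formulas L A {0} :: ('f, 'r, 'a) fm set| \<le>o r"
      by (rule card_of_formulas[OF complete_theory r T A])
  qed
  have "|UNIV :: (nat \<times> nat \<times> nat) set| \<le>o r"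
    unfolding UNIV_Times_UNIV[symmetric] by (intro card_of_Times_bound card_of_nat_bound r)
  then have "|B| \<le>o r"
    unfolding B_def by (intro card_of_image_bound card_of_Times_bound card_of_lists_bound r p F)
  moreover have "y \<otimes> inv z \<in> core"
    if yz: "y \<in> carrier G" "z \<in> carrier G" "same_type B y z" for y z
  proof -
    have "y \<otimes> inv z \<in> triple_products q \<Delta> d'"
      if q: "finite q" "q \<subseteq> p" and \<Delta>: "set \<Delta> \<subseteq> ?F" for q \<Delta> d'
    proof -
      obtain qs where qs: "set qs = q" using finite_list[OF q(1)] by blast
      have "agree \<Delta> d y z" if d: "d \<in> set (D qs \<Delta>)" for d
        unfolding agree_def
      proof (intro allI impI)
        fix k assume k: "k < length \<Delta>"
        obtain m where m: "D qs \<Delta> ! m = d" using d by (metis in_set_conv_nth)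
        have "range (d k) \<subseteq> B"
        proof
          fix a assume "a \<in> range (d k)"
          then obtain l where "a = (D qs \<Delta> ! m) k l" using m by blast
          then show "a \<in> B"
            unfolding B_def using qs q(2) \<Delta>
            by (intro image_eqI[where x = "((qs, \<Delta>), m, k, l)"]) auto
        qed
        then have "definable B (\<lambda>u. sat M ((d k)(0 := u 0)) (\<Delta> ! k))"
          using definable_mono[OF definable_instance] \<Delta> nth_mem[OF k] by blast
        then show "sat M ((d k)(0 := y)) (\<Delta> ! k) \<longleftrightarrow> sat M ((d k)(0 := z)) (\<Delta> ! k)"
          by (rule same_type_definable[OF yz(3), where S = "\<lambda>a. sat M ((d k)(0 := a)) (\<Delta> ! k)"])
      qed
      then have "\<forall>d\<in>set (D qs \<Delta>). y \<otimes> inv z \<in> quotients p \<Delta> d"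
        using quotients_p[OF yz(1,2)] by blast
      then show ?thesis using D[of qs \<Delta>] qs q(2) \<Delta> yz(1,2) unfolding good_def by simp
    qed
    then show ?thesis using yz(1,2) unfolding core_def by simp
  qed
  ultimately show ?thesis by blast
qed

text \<open>The type over \<open>B\<close> of any element determines its coset, so there are at most
  as many cosets as sets of formulas over \<open>B\<close>.\<close>

lemma index_component:
  assumes r: "Cinfinite r" and A: "|A| \<le>o r" and T: "|T| \<le>o r"
  shows "index G component \<le>o ctwo ^c r"
proof -
  obtain B where B: "|B| \<le>o r" and core:
    "\<And>y z. y \<in> carrier G \<Longrightarrow> z \<in> carrier G \<Longrightarrow> same_type B y z \<Longrightarrow> y \<otimes> inv z \<in> core"
    using quotients_in_core[OF assms] by blast
  let ?F = "formulas L B {0} :: ('f, 'r, 'a) fm set"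
  let ?tp = "\<lambda>y. {\<phi> \<in> ?F. sat M (\<lambda>_. y) \<phi>}"
  have "rcosets component \<subseteq> (\<lambda>t. component #> (SOME y. y \<in> carrier G \<and> ?tp y = t)) ` Pow ?F"
  proof
    fix X assume "X \<in> rcosets component"
    then obtain y where y: "y \<in> carrier G" "X = component #> y" unfolding RCOSETS_def by blast
    let ?z = "SOME z. z \<in> carrier G \<and> ?tp z = ?tp y"
    have "?z \<in> carrier G \<and> ?tp ?z = ?tp y" by (rule someI[of _ y]) (use y(1) in simp)
    then have z: "?z \<in> carrier G" "same_type B y ?z" unfolding same_type_def by blast+
    then have "y \<otimes> inv ?z \<in> component"
      using core[OF y(1) z] unfolding component_def by (intro generate.incl)
    moreover have "y = (y \<otimes> inv ?z) \<otimes> ?z" using y(1) z(1) by (simp add: m_assoc)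
    ultimately have "y \<in> component #> ?z" unfolding r_coset_def by blast
    then have "component #> ?z = X"
      using repr_independence[OF _ z(1) subgroup_component] y(2) by simp
    then show "X \<in> (\<lambda>t. component #> (SOME y. y \<in> carrier G \<and> ?tp y = t)) ` Pow ?F"
      by (intro image_eqI[of _ _ "?tp y"]) auto
  qed
  moreover have "|Pow ?F| \<le>o ctwo ^c r"
    using card_of_formulas[OF complete_theory r T B] r by (intro card_of_Pow_bound) auto
  ultimately show ?thesis unfolding index_def by (rule card_of_subset_image_bound)
qed

text \<open>A coset of \<open>K\<close> lies in a single coset of \<open>H\<close>, which any of its
  elements represents.\<close>

lemma index_antimono:
  assumes H: "subgroup H G" and K: "subgroup K G" and "K \<subseteq> H"
  shows "index G H \<le>o index G K"
  unfolding index_def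
proof (rule card_of_subset_image_bound)
  show "rcosets H \<subseteq> (\<lambda>X. H #> (SOME x. x \<in> X)) ` (rcosets K)"
  proof
    fix Y assume "Y \<in> rcosets H"
    then obtain x where x: "x \<in> carrier G" "Y = H #> x" unfolding RCOSETS_def by blast
    have "(SOME y. y \<in> K #> x) \<in> K #> x" by (rule someI[where P = "\<lambda>y. y \<in> K #> x", OF rcos_self[OF x(1) K]])
    then have "(SOME y. y \<in> K #> x) \<in> H #> x" using \<open>K \<subseteq> H\<close> unfolding r_coset_def by blast
    then have "Y = H #> (SOME y. y \<in> K #> x)" using repr_independence[OF _ x(1) H] x(2) by simp
    moreover have "K #> x \<in> rcosets K" using x(1) unfolding RCOSETS_def by blast
    ultimately show "Y \<in> (\<lambda>X. H #> (SOME x. x \<in> X)) ` (rcosets K)" by blast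
  qed
  show "|rcosets K| \<le>o |rcosets K|" by (rule card_of_mono1) simp
qed

section \<open>Minimality\<close>

lemma definable_sat_mult:
  assumes \<phi>: "\<phi> \<in> formulas L B {0}" and "A \<subseteq> B"
  shows "definable B (\<lambda>v. sat M (\<lambda>_. v i \<otimes> v j) \<phi>)"
proof -
  define k where "k = Suc (i + j)"
  let ?R = "\<lambda>v. v i \<otimes> v j = v k \<and> sat M (\<lambda>_. v k) \<phi>"
  have "definable B ?R"
    by (intro definable_conj definable_sat_at[OF \<phi>] definable_mono[OF definable_mult \<open>A \<subseteq> B\<close>])
  then have "definable B (\<lambda>v. \<exists>a. ?R (v(k := a)))" by (rule definable_ex)
  moreover have "(\<exists>a. ?R (v(k := a))) \<longleftrightarrow> sat M (\<lambda>_. v i \<otimes> v j) \<phi>" for v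
    by (simp add: k_def)
  ultimately show ?thesis by (simp only:)
qed

text \<open>\<open>N\<close> contains representatives of the cosets of \<open>H\<close>, so the type of \<open>z\<close> over \<open>N\<close>
  determines its coset.\<close>

lemma bounded_index_types:
  assumes H: "subgroup H G" and def: "union_type_definable L \<kappa> M H" and "index G H <o \<kappa>"
  obtains N where "small N" "A \<subseteq> N"
    "\<And>u z. \<lbrakk>u \<in> carrier G; z \<in> carrier G; same_type N z (u \<otimes> z)\<rbrakk> \<Longrightarrow> u \<in> H"
proof -
  obtain B P where "small B" and P: "\<forall>h\<in>P. type_over L M B h" and H_eq: "H = union_realizations M P"
    using def unfolding union_type_definable_def by blast
  \<comment> \<open>Inverses of the representatives enter \<open>N\<close>, so that lying in a given
    coset becomes a condition on \<open>z \<otimes> t\<close> with \<open>t \<in> N\<close>.\<close>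
  let ?rep = "\<lambda>X. inv (SOME x. x \<in> X)"
  define N where "N = A \<union> B \<union> ?rep ` (rcosets H)"
  have "small N"
    unfolding N_def using \<open>index G H <o \<kappa>\<close> unfolding index_def
    by (intro small_Un small_A \<open>small B\<close> small_image)
  have "u \<in> H" if u: "u \<in> carrier G" and z: "z \<in> carrier G" and type: "same_type N z (u \<otimes> z)" for u z
  proof -
    let ?x = "SOME x. x \<in> H #> z"
    have "?x \<in> H #> z" by (rule someI[where P = "\<lambda>x. x \<in> H #> z", OF rcos_self[OF z H]])
    then obtain h where h: "h \<in> H" "?x = h \<otimes> z" unfolding r_coset_def by blast
    have hG: "h \<in> carrier G" using h(1) subgroup.subset[OF H] by blast
    have x: "?x \<in> carrier G" unfolding h(2) using hG z by simp
    define t where "t = inv ?x"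
    have t: "t \<in> carrier G" "t \<in> N" using x z unfolding t_def N_def RCOSETS_def by auto
    have "z \<otimes> t = inv h" unfolding t_def h(2) using hG z by (simp add: inv_mult m_lcomm[of z "inv h"])
    then have zt: "z \<otimes> t \<in> H" using subgroup.m_inv_closed[OF H h(1)] by simp
    \<comment> \<open>The one type of the union that \<open>z \<otimes> t\<close> realizes is
      transferred, formula by formula, to \<open>(u \<otimes> z) \<otimes> t\<close>.\<close>
    then obtain q where q: "q \<in> P" "z \<otimes> t \<in> realizations M q"
      unfolding H_eq union_realizations_def by blast
    have "sat M (\<lambda>_. (u \<otimes> z) \<otimes> t) \<phi>" if "\<phi> \<in> q" for \<phi>
    proof -
      have "\<phi> \<in> formulas L N {0}"
        using P q(1) that unfolding type_over_def formulas_def N_def by blast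
      then have "definable N (\<lambda>v. sat M (\<lambda>_. v 0 \<otimes> v 1) \<phi>)"
        by (rule definable_sat_mult) (auto simp: N_def)
      from definable_subst_const[OF this t(2), of 1]
      have "definable N (\<lambda>v. sat M (\<lambda>_. v 0 \<otimes> t) \<phi>)" by simp
      from same_type_definable[OF type this] show ?thesis
        using q(2) that unfolding realizations_def by blast
    qed
    then have "(u \<otimes> z) \<otimes> t \<in> H"
      using q(1) unfolding H_eq union_realizations_def realizations_def by blast
    then have "(u \<otimes> z) \<otimes> t \<otimes> inv (z \<otimes> t) \<in> H"
      using subgroup.m_closed[OF H] subgroup.m_inv_closed[OF H zt] by blast
    moreover have "(u \<otimes> z) \<otimes> t \<otimes> inv (z \<otimes> t) = u" using u z t(1) by (simp add: m_assoc)
    ultimately show "u \<in> H" by simp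
  qed
  then show ?thesis using that[of N] \<open>small N\<close> unfolding N_def by blast
qed

text \<open>Saturation is applied to a type in three factors \<open>v 0\<close>, \<open>v 1\<close>,
  \<open>v 2\<close> and three denominators \<open>v 3\<close>, \<open>v 4\<close>,
  \<open>v 5\<close>. A finite part involves finitely many formulas over \<open>N\<close>; their
  parameters form a tuple \<open>d\<close>, for which \<open>x \<in> core\<close> supplies a
  solution.\<close>

lemma core_triple_product:
  assumes "small N" "A \<subseteq> N" and x: "x \<in> core"
  obtains v :: "nat \<Rightarrow> 'a" where "x = v 0 \<otimes> v 1 \<otimes> v 2"
    "\<And>i. i < 3 \<Longrightarrow> v i \<in> carrier G \<and> v (i + 3) \<in> carrier G \<and> same_type N (v (i + 3)) (v i \<otimes> v (i + 3))"
proof -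
  let ?F = "formulas L N {0} :: ('f, 'r, 'a) fm set"
  define R where "R \<phi> v \<longleftrightarrow> (\<forall>i\<in>{..<3::nat}. sat M (\<lambda>_. v i) \<phi> \<and> sat M (\<lambda>_. v (i + 3)) \<phi> \<and>
    sat M (\<lambda>_. v i \<otimes> v (i + 3)) \<phi>)" for \<phi> and v :: "nat \<Rightarrow> 'a"
  define S where "S \<chi> v \<longleftrightarrow> (\<forall>i\<in>{..<3::nat}. sat M (\<lambda>_. v (i + 3)) \<chi> = sat M (\<lambda>_. v i \<otimes> v (i + 3)) \<chi>)"
    for \<chi> and v :: "nat \<Rightarrow> 'a"
  define E where "E v \<longleftrightarrow> v 0 \<otimes> v 1 \<otimes> v 2 = x" for v :: "nat \<Rightarrow> 'a"
  have p_F: "p \<subseteq> ?F" using p_formulas \<open>A \<subseteq> N\<close> unfolding formulas_def by blast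
  have R: "definable N (R \<phi>)" if "\<phi> \<in> ?F" for \<phi>
    unfolding R_def
    by (intro definable_ball definable_conj definable_sat_at definable_sat_mult that \<open>A \<subseteq> N\<close>) auto
  have S: "definable N (S \<chi>)" if "\<chi> \<in> ?F" for \<chi>
    unfolding S_def
    by (intro definable_ball definable_iff definable_sat_at definable_sat_mult that \<open>A \<subseteq> N\<close>) auto
  have E: "definable (insert x N) E"
  proof -
    \<comment> \<open>The variables 6 and 7 lie outside the six unknowns: 6 holds the partial
      product and is quantified, 7 becomes the constant \<open>x\<close>.\<close>
    have "definable (insert x N) (\<lambda>v. v 0 \<otimes> v 1 = v 6 \<and> v 6 \<otimes> v 2 = v 7)"
      by (intro definable_conj definable_mono[OF definable_mult]) (use \<open>A \<subseteq> N\<close> in auto)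
    from definable_ex[OF definable_subst_const[OF this, of x 7], of 6] show ?thesis
      unfolding E_def by simp
  qed
  have "\<exists>v. \<forall>Q\<in>R ` p \<union> S ` ?F \<union> {E}. Q v"
  proof (rule saturation[where n = 6])
    show "small (insert x N)" using small_Un[OF small_finite[of "{x}"] \<open>small N\<close>] by simp
    show "definable (insert x N) Q" if "Q \<in> R ` p \<union> S ` ?F \<union> {E}" for Q
      using that E R S p_F definable_mono[of N _ "insert x N"] by blast
    show "Q v = Q w" if Q: "Q \<in> R ` p \<union> S ` ?F \<union> {E}" and vw: "\<And>i. i < 6 \<Longrightarrow> v i = w i"
      for Q and v w :: "nat \<Rightarrow> 'a"
    proof -
      have "R \<phi> v = R \<phi> w" "S \<phi> v = S \<phi> w" for \<phi>
        unfolding R_def S_def using vw by (auto intro!: ball_cong)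
      moreover have "E v = E w" unfolding E_def using vw by simp
      ultimately show ?thesis using Q by blast
    qed
    fix X assume X: "finite X" "X \<subseteq> R ` p \<union> S ` ?F \<union> {E}"
    obtain q where q: "q \<subseteq> p" "finite q" "X \<inter> R ` p = R ` q"
      using finite_subset_image[of "X \<inter> R ` p" R p] X(1) by auto
    obtain Z where Z: "Z \<subseteq> ?F" "finite Z" "X \<inter> S ` ?F = S ` Z"
      using finite_subset_image[of "X \<inter> S ` ?F" S ?F] X(1) by auto
    obtain \<chi>s where \<chi>s: "set \<chi>s = Z" using finite_list[OF Z(2)] by blast
    have "\<exists>gc. \<forall>\<chi>\<in>?F. fst (gc \<chi>) \<in> formulas L {} UNIV \<and>
        (\<forall>v. sat M (\<lambda>k. if even k then v (k div 2) else snd (gc \<chi>) k) (fst (gc \<chi>)) = sat M v \<chi>)"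
    proof (intro bchoice ballI)
      fix \<chi> assume "\<chi> \<in> ?F"
      from abstract_parameters[OF this, of M] obtain \<chi>' c where "\<chi>' \<in> formulas L {} UNIV"
        "\<forall>v. sat M (\<lambda>k. if even k then v (k div 2) else c k) \<chi>' = sat M v \<chi>"
        by (elim exE conjE)
      then show "\<exists>gc. fst gc \<in> formulas L {} UNIV \<and>
        (\<forall>v. sat M (\<lambda>k. if even k then v (k div 2) else snd gc k) (fst gc) = sat M v \<chi>)"
        by (intro exI[of _ "(\<chi>', c)"]) (unfold fst_conv snd_conv, rule conjI)
    qed
    then obtain gc where gc: "\<forall>\<chi>\<in>?F. fst (gc \<chi>) \<in> formulas L {} UNIV \<and>
        (\<forall>v. sat M (\<lambda>k. if even k then v (k div 2) else snd (gc \<chi>) k) (fst (gc \<chi>)) = sat M v \<chi>)"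
      by (rule exE)
    define \<Delta> where "\<Delta> = map (fst \<circ> gc) \<chi>s"
    \<comment> \<open>The odd variables regain the parameters of \<open>\<chi>s ! k\<close>. The
      default at the even ones is harmless, as \<open>\<chi>s ! k\<close> has no free variable
      besides 0, which \<open>agree\<close> overwrites.\<close>
    define d where "d k m = (if even m then undefined else snd (gc (\<chi>s ! k)) m)" for k m
    have "set \<Delta> \<subseteq> formulas L {} UNIV" unfolding \<Delta>_def using gc Z(1) \<chi>s by auto
    then have "x \<in> triple_products q \<Delta> d" using x q(1,2) unfolding core_def by blast
    then obtain u\<^sub>0 u\<^sub>1 u\<^sub>2 where u': "u\<^sub>0 \<in> quotients q \<Delta> d" "u\<^sub>1 \<in> quotients q \<Delta> d"
      "u\<^sub>2 \<in> quotients q \<Delta> d" "x = u\<^sub>0 \<otimes> u\<^sub>1 \<otimes> u\<^sub>2"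
      unfolding triple_products_def by blast
    define u where "u i = (if i = 0 then u\<^sub>0 else if i = 1 then u\<^sub>1 else u\<^sub>2)" for i :: nat
    have u: "\<And>i. u i \<in> quotients q \<Delta> d" "x = u 0 \<otimes> u 1 \<otimes> u 2"
      unfolding u_def using u' by auto
    have "\<forall>i. \<exists>z. u i \<in> realizations M q \<and> z \<in> realizations M q \<and>
        u i \<otimes> z \<in> realizations M q \<and> agree \<Delta> d z (u i \<otimes> z)"
      using u(1) unfolding quotients_def by blast
    from choice[OF this] obtain z where z: "\<And>i. u i \<in> realizations M q \<and> z i \<in> realizations M q \<and>
        u i \<otimes> z i \<in> realizations M q \<and> agree \<Delta> d (z i) (u i \<otimes> z i)"
      by blast
    define v where "v i = (if i < 3 then u i else z (i - 3))" for i
    have v: "v i = u i" "v (i + 3) = z i" if "i < 3" for i using that by (auto simp: v_def)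
    have sat_\<Delta>: "sat M ((d k)(0 := y)) (\<Delta> ! k) = sat M (\<lambda>_. y) (\<chi>s ! k)" if k: "k < length \<chi>s" for k y
    proof -
      let ?w = "\<lambda>i. if i = 0 then y else undefined"
      have \<chi>: "\<chi>s ! k \<in> ?F" using Z(1) \<chi>s k nth_mem by blast
      have "(d k)(0 := y) = (\<lambda>m. if even m then ?w (m div 2) else snd (gc (\<chi>s ! k)) m)"
        by (auto simp: d_def fun_eq_iff elim!: evenE)
      then show ?thesis
        using gc[rule_format, OF \<chi>, THEN conjunct2, rule_format, of ?w]
          sat_one_variable[OF \<chi>, of ?w y] k
        by (simp add: \<Delta>_def)
    qed
    have Rv: "R \<phi> v" if "\<phi> \<in> q" for \<phi>
      unfolding R_def using z that v unfolding realizations_def by auto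
    have Sv: "S \<chi> v" if \<chi>: "\<chi> \<in> Z" for \<chi>
    proof -
      obtain k where k: "k < length \<chi>s" "\<chi> = \<chi>s ! k" using \<chi>s \<chi> by (metis in_set_conv_nth)
      have "sat M ((d k)(0 := z i)) (\<Delta> ! k) = sat M ((d k)(0 := u i \<otimes> z i)) (\<Delta> ! k)" for i
        using z[of i] k(1) unfolding agree_def \<Delta>_def by simp
      then have "sat M (\<lambda>_. z i) \<chi> = sat M (\<lambda>_. u i \<otimes> z i) \<chi>" for i
        by (simp only: sat_\<Delta>[OF k(1)] k(2))
      then show ?thesis unfolding S_def using v by auto
    qed
    have Ev: "E v" unfolding E_def v_def using u(2) by simp
    have "Q v" if "Q \<in> X" for Q
    proof -
      consider "Q \<in> X \<inter> R ` p" | "Q \<in> X \<inter> S ` ?F" | "Q = E" using \<open>Q \<in> X\<close> X(2) by blast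
      then show ?thesis unfolding q(3) Z(3) by cases (use Rv Sv Ev in auto)
    qed
    then show "\<exists>v. \<forall>Q\<in>X. Q v" by blast
  qed
  then obtain v where v: "\<And>\<phi>. \<phi> \<in> p \<Longrightarrow> R \<phi> v" "\<And>\<chi>. \<chi> \<in> ?F \<Longrightarrow> S \<chi> v" "E v" by blast
  show ?thesis
  proof (rule that)
    show "x = v 0 \<otimes> v 1 \<otimes> v 2" using v(3) unfolding E_def by simp
    show "v i \<in> carrier G \<and> v (i + 3) \<in> carrier G \<and> same_type N (v (i + 3)) (v i \<otimes> v (i + 3))"
      if "i < 3" for i
      using v(1,2) that unfolding R_def S_def carrier_eq realizations_def same_type_def by auto
  qed
qed

lemma component_minimal:
  assumes H: "subgroup H G" and "union_type_definable L \<kappa> M H" and "index G H <o \<kappa>"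
  shows "component \<subseteq> H"
proof -
  obtain N where N: "small N" "A \<subseteq> N"
    "\<And>u z. \<lbrakk>u \<in> carrier G; z \<in> carrier G; same_type N z (u \<otimes> z)\<rbrakk> \<Longrightarrow> u \<in> H"
    using bounded_index_types[OF assms] by metis
  have "core \<subseteq> H"
  proof
    fix x assume "x \<in> core"
    then obtain v :: "nat \<Rightarrow> 'a" where v: "x = v 0 \<otimes> v 1 \<otimes> v 2"
      "\<And>i. i < 3 \<Longrightarrow> v i \<in> carrier G \<and> v (i + 3) \<in> carrier G \<and> same_type N (v (i + 3)) (v i \<otimes> v (i + 3))"
      using core_triple_product[OF N(1,2)] by metis
    have "v i \<in> H" if "i < 3" for i using N(3) v(2)[OF that] by blast
    then show "x \<in> H" unfolding v(1) using subgroup.m_closed[OF H] by simp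
  qed
  then show ?thesis unfolding component_def using H by (rule generate_subgroup_incl)
qed

section \<open>Invariance over \<open>A\<close>\<close>

text \<open>Since \<open>d\<close> ranges over the whole model, it can be quantified: being outside
  some \<open>triple_products q \<Delta> d\<close> is a property definable over
  \<open>A\<close>.\<close>

lemma core_invariant:
  assumes "same_type A x x'" and x: "x \<in> core"
  shows "x' \<in> core"
proof -
  have "x' \<in> triple_products q \<Delta> d" if "finite q" "q \<subseteq> p" "set \<Delta> \<subseteq> formulas L {} UNIV" for q \<Delta> d
  proof (rule ccontr)
    assume not: "x' \<notin> triple_products q \<Delta> d"
    let ?Q = "\<lambda>w. w 0 \<notin> triple_products q \<Delta> (\<lambda>k l. w (code k l))"
    have "definable A ?Q" by (intro definable_neg definable_triple_products that)
    from same_type_definable[OF assms(1) definable_ex_others[OF this]]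
    have iff: "(\<exists>w. w 0 = x \<and> ?Q w) \<longleftrightarrow> (\<exists>w. w 0 = x' \<and> ?Q w)" .
    define w where "w i = (if i = 0 then x' else case prod_decode (i - 10) of (k, l) \<Rightarrow> d k l)" for i
    have "w 0 = x'" "(\<lambda>k l. w (code k l)) = d" by (auto simp: w_def code_def)
    then have "\<exists>w. w 0 = x' \<and> ?Q w" using not by metis
    then obtain w where "w 0 = x" "?Q w" using iff by blast
    then show False using x that unfolding core_def by blast
  qed
  moreover have "x' \<in> carrier G" using same_type_carrier[OF assms(1)] x core_subset_carrier by blast
  ultimately show ?thesis unfolding core_def by blast
qed

lemma definable_sat_left_quotient:
  assumes "\<phi> \<in> formulas L A {0}"
  shows "definable A (\<lambda>v. sat M (\<lambda>_. inverse_op (v 1) \<otimes> v 0) \<phi>)"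
proof -
  let ?R = "\<lambda>v. inverse_op (v 1) = v 2 \<and> sat M (\<lambda>_. v 2 \<otimes> v 0) \<phi>"
  have "definable A (\<lambda>v. inverse_op (v 1) = v 2)"
    using definable_rename[OF definable_inverse_op inj_Suc] by (simp add: numeral_2_eq_2)
  then have "definable A ?R"
    by (intro definable_conj definable_sat_mult[OF assms order_refl])
  from definable_ex[OF this, of 2] show ?thesis by simp
qed

text \<open>One back-and-forth step: finitely many conditions on \<open>h\<close> form an
  existential formula true of \<open>x\<close>, hence of \<open>x'\<close>, and saturation over
  \<open>insert x' A\<close> satisfies all conditions together.\<close>

lemma homogeneity:
  assumes "same_type A x x'"
  obtains h' where "same_type A h h'" "same_type A (inverse_op h \<otimes> x) (inverse_op h' \<otimes> x')"
proof -
  let ?F = "formulas L A {0} :: ('f, 'r, 'a) fm set"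
  define R where "R \<phi> y a \<longleftrightarrow> (sat M (\<lambda>_. a) \<phi> \<longleftrightarrow> sat M (\<lambda>_. h) \<phi>) \<and>
    (sat M (\<lambda>_. inverse_op a \<otimes> y) \<phi> \<longleftrightarrow> sat M (\<lambda>_. inverse_op h \<otimes> x) \<phi>)" for \<phi> y a
  have const: "definable A (\<lambda>v. b)" for b
    using definable_True[of A] definable_neg[OF definable_True, of A] by (cases b) auto
  have R: "definable A (\<lambda>v. R \<phi> (v 0) (v 1))" if "\<phi> \<in> ?F" for \<phi>
    unfolding R_def
    by (intro definable_conj definable_iff definable_sat_at definable_sat_left_quotient const that)
  have "\<exists>a. \<forall>Q\<in>(\<lambda>\<phi>. R \<phi> x') ` ?F. Q a"
  proof (rule saturation_one_variable)
    show "small (insert x' A)" using small_Un[OF small_finite[of "{x'}"] small_A] by simp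
    fix Q assume "Q \<in> (\<lambda>\<phi>. R \<phi> x') ` ?F"
    then obtain \<phi> where \<phi>: "\<phi> \<in> ?F" "Q = R \<phi> x'" by blast
    have "definable (insert x' A) (\<lambda>v. R \<phi> (v 0) (v 1))"
      by (rule definable_mono[OF R[OF \<phi>(1)]]) blast
    \<comment> \<open>The variable 2 keeps the unknown while 0 is filled with \<open>x'\<close>;
      afterwards the unknown moves to 0.\<close>
    from definable_subst_const[OF definable_subst_var[OF this, of 1 2], of x' 0]
    have "definable (insert x' A) (\<lambda>v. R \<phi> x' (v 2))" by simp
    from definable_subst_var[OF this, of 2 0] show "definable (insert x' A) (\<lambda>v. Q (v 0))"
      using \<phi>(2) by simp
  next
    fix X assume X: "finite X" "X \<subseteq> (\<lambda>\<phi>. R \<phi> x') ` ?F"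
    obtain Y where Y: "Y \<subseteq> ?F" "finite Y" "X = (\<lambda>\<phi>. R \<phi> x') ` Y"
      using finite_subset_image[OF X] by blast
    have "definable A (\<lambda>v. \<forall>\<phi>\<in>Y. R \<phi> (v 0) (v 1))"
      using Y(1,2) R by (intro definable_ball) auto
    from definable_ex[OF this, of 1] have "definable A (\<lambda>v. \<exists>a. \<forall>\<phi>\<in>Y. R \<phi> (v 0) a)" by simp
    from same_type_definable[OF assms this]
    have "(\<exists>a. \<forall>\<phi>\<in>Y. R \<phi> x a) \<longleftrightarrow> (\<exists>a. \<forall>\<phi>\<in>Y. R \<phi> x' a)" .
    moreover have "\<forall>\<phi>\<in>Y. R \<phi> x h" unfolding R_def by simp
    ultimately show "\<exists>a. \<forall>Q\<in>X. Q a" using Y(3) by auto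
  qed
  then obtain h' where h': "\<forall>\<phi>\<in>?F. R \<phi> x' h'" by auto
  show ?thesis
    by (rule that[of h']) (use h' in \<open>auto simp: R_def same_type_def\<close>)
qed

text \<open>This makes the component a union of complete types over \<open>A\<close>. By induction
  on generation: for a product \<open>h1 \<otimes> h2\<close>, homogeneity splits \<open>x'\<close>
  into factors with the types of \<open>h1\<close> and \<open>h2\<close>.\<close>

lemma component_invariant:
  assumes "x \<in> component" "same_type A x x'"
  shows "x' \<in> component"
proof -
  have "\<forall>x'. same_type A x x' \<longrightarrow> x' \<in> generate G core" if "x \<in> generate G core" for x
    using that
  proof (induction rule: generate.induct)
    case one
    have "x' = \<one>" if "same_type A \<one> x'" for x'
      using same_type_definable[OF that definable_one] by simp
    then show ?case using generate.one by metis
  next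
    case (incl h)
    then show ?case using core_invariant generate.incl by metis
  next
    case (inv h)
    show ?case
    proof (intro allI impI)
      fix x' assume type: "same_type A (inv h) x'"
      have h: "h \<in> carrier G" using inv core_subset_carrier by blast
      then have x': "x' \<in> carrier G" using same_type_carrier[OF type] by simp
      have "same_type A h (inv x')"
        unfolding same_type_def
      proof
        fix \<phi> :: "('f, 'r, 'a) fm" assume \<phi>: "\<phi> \<in> formulas L A {0}"
        \<comment> \<open>At \<open>inv h\<close> this predicate says that \<open>h\<close>
          satisfies \<open>\<phi>\<close>, at \<open>x'\<close> that \<open>inv x'\<close>
          does.\<close>
        have "definable A (\<lambda>v. \<exists>a. inverse_op (v 0) = a \<and> sat M (\<lambda>_. a) \<phi>)"
          using definable_ex[OF definable_conj[OF definable_inverse_op definable_sat_at[OF \<phi>, of 1]], of 1]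
          by simp
        from same_type_definable[OF type this] show "sat M (\<lambda>_. h) \<phi> \<longleftrightarrow> sat M (\<lambda>_. inv x') \<phi>"
          using inverse_op h x' by simp
      qed
      then have "inv x' \<in> core" using core_invariant inv by blast
      then have "inv (inv x') \<in> generate G core" by (rule generate.inv)
      then show "x' \<in> generate G core" using x' by simp
    qed
  next
    case (eng h1 h2)
    show ?case
    proof (intro allI impI)
      fix x' assume type: "same_type A (h1 \<otimes> h2) x'"
      have h: "h1 \<in> carrier G" "h2 \<in> carrier G"
        using eng generate_incl[OF core_subset_carrier] by blast+
      then have x': "x' \<in> carrier G" using same_type_carrier[OF type] by simp
      obtain h' where h': "same_type A h1 h'"
        "same_type A (inverse_op h1 \<otimes> (h1 \<otimes> h2)) (inverse_op h' \<otimes> x')"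
        using homogeneity[OF type] by metis
      have h'G: "h' \<in> carrier G" using same_type_carrier[OF h'(1) h(1)] .
      have "inverse_op h1 \<otimes> (h1 \<otimes> h2) = h2"
        using inverse_op[OF h(1)] h by (simp add: m_assoc[symmetric])
      then have "inv h' \<otimes> x' \<in> generate G core"
        using eng h'(2) inverse_op[OF h'G] by simp
      moreover have "h' \<in> generate G core" using eng h'(1) by blast
      ultimately have "h' \<otimes> (inv h' \<otimes> x') \<in> generate G core" by (rule generate.eng[rotated])
      then show "x' \<in> generate G core" using h'G x' by (simp add: m_assoc[symmetric])
    qed
  qed
  then show ?thesis using assms unfolding component_def by blast
qed

end

section \<open>Assembly of the theorem\<close>

theorem theorem1p12:
  fixes L :: "('f, 'r) language"
    and T :: "('f, 'r, 'a) fm set"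
    and C :: "('f, 'r, 'a) struct"
    and \<kappa> :: "'k rel"
    and A :: "'a set"
    and p :: "('f, 'r, 'a) fm set"
    and mul :: "'a \<Rightarrow> 'a \<Rightarrow> 'a"
    and inverse_op :: "'a \<Rightarrow> 'a"
    and e :: "'a"
    and G :: "'a monoid"
  assumes "complete_theory L T"
    and "dependent_theory L T"
    and "strongly_inaccessible \<kappa>"
    and "|T| <o \<kappa>"
    and "is_model C T"
    and "saturated L \<kappa> C"
    and "|A| <o \<kappa>"
    and "type_over L C A p"
    and "definable_over L C A 3 (\<lambda>v. mul (v 0) (v 1) = v 2)"
    and "definable_over L C A 2 (\<lambda>v. inverse_op (v 0) = v 1)"
    and "definable_over L C A 1 (\<lambda>v. v 0 = e)"
    and "G = \<lparr>carrier = realizations C p, mult = mul, one = e\<rparr>"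
    and "comm_group G"
    and "\<forall>x\<in>carrier G. inverse_op x = inv\<^bsub>G\<^esub> x"
  shows "\<exists>P \<subseteq> complete_types L C A.
      subgroup (union_realizations C P) G \<and>
      index G (union_realizations C P) <o \<kappa> \<and>
      index G (union_realizations C P) \<le>o ctwo ^c ( |A| +c |T| +c natLeq) \<and>
      (\<forall>H. subgroup H G \<and> union_type_definable L \<kappa> C H \<longrightarrow>
         (index G H <o \<kappa> \<longleftrightarrow> union_realizations C P \<subseteq> H))"
proof -
  interpret fo_structure L C .
  have def: "definable A R" if "definable_over L C A n R" for n R
    using that unfolding definable_over_def definable_def formulas_def by blast
  interpret comm_group G by fact
  interpret type_definable_group L C \<kappa> G T A p inverse_op
  proof
    show "definable A (\<lambda>v. v 0 \<otimes>\<^bsub>G\<^esub> v 1 = v 2)" "definable A (\<lambda>v. inverse_op (v 0) = v 1)"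
      "definable A (\<lambda>v. v 0 = \<one>\<^bsub>G\<^esub>)"
      using def[OF assms(9)] def[OF assms(10)] def[OF assms(11)] assms(12) by simp_all
    show "carrier G = realizations C p" using assms(12) by simp
  qed (use assms in auto)
  let ?r = "|A| +c |T| +c natLeq"
  have r: "Cinfinite ?r"
    using natLeq_Cinfinite by (simp add: Cinfinite_csum)
  have "|A| \<le>o ?r" by (rule ordLeq_csum1) (rule card_of_Card_order)
  moreover have "|T| \<le>o ?r"
    by (rule ordLeq_transitive[OF ordLeq_csum1 ordLeq_csum2]) (simp_all add: card_of_Card_order Card_order_csum)
  ultimately have index: "index G component \<le>o ctwo ^c ?r" by (rule index_component[OF r])
  \<comment> \<open>The explicit bound in (b) then implies (a), because \<open>\<kappa>\<close> is
    closed under powers of two.\<close>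
  have "?r <o \<kappa>"
    using assms(3,4,7) Cinfinite ordIso_ordLess_trans[OF card_of_nat]
    unfolding strongly_inaccessible_def csum_def cinfinite_def Field_card_of Field_natLeq
    by (intro card_of_Plus_ordLess_infinite_Field) auto
  then have small: "index G component <o \<kappa>"
    using ordLeq_ordLess_trans[OF index small_ctwo_power] r by blast
  \<comment> \<open>These are the complete types over \<open>A\<close> of the elements of the
    component; by invariance their realizations stay inside it.\<close>
  define P where "P = (\<lambda>x. {\<phi> \<in> formulas L A {0}. sat C (\<lambda>_. x) \<phi>}) ` component"
  have "P \<subseteq> complete_types L C A"
    unfolding P_def complete_types_def type_over_def by (auto simp: formulas_def)
  moreover have "union_realizations C P = component"
  proof
    show "component \<subseteq> union_realizations C P"
      unfolding P_def union_realizations_def realizations_def by blast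
    show "union_realizations C P \<subseteq> component"
    proof
      fix y assume "y \<in> union_realizations C P"
      then obtain x where x: "x \<in> component"
        "\<And>\<phi>. \<phi> \<in> formulas L A {0} \<Longrightarrow> sat C (\<lambda>_. x) \<phi> \<Longrightarrow> sat C (\<lambda>_. y) \<phi>"
        unfolding P_def union_realizations_def realizations_def by blast
      have "same_type A x y"
        unfolding same_type_def
      proof
        fix \<phi> :: "('f, 'r, 'a) fm" assume \<phi>: "\<phi> \<in> formulas L A {0}"
        then have "Neg \<phi> \<in> formulas L A {0}" unfolding formulas_def by simp
        \<comment> \<open>Applied to \<open>Neg \<phi>\<close>, the inclusion of types yields the
          converse implication.\<close>
        then show "sat C (\<lambda>_. x) \<phi> \<longleftrightarrow> sat C (\<lambda>_. y) \<phi>" using x(2)[OF \<phi>] x(2)[of "Neg \<phi>"] by auto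
      qed
      then show "y \<in> component" by (rule component_invariant[OF x(1)])
    qed
  qed
  \<comment> \<open>One direction is minimality; conversely, a subgroup containing the component has
    at most its index.\<close>
  moreover have "index G H <o \<kappa> \<longleftrightarrow> component \<subseteq> H"
    if "subgroup H G" "union_type_definable L \<kappa> C H" for H
    using component_minimal[OF that]
      ordLeq_ordLess_trans[OF index_antimono[OF that(1) subgroup_component] small] by blast
  ultimately show ?thesis
    using subgroup_component small index by (intro exI[of _ P]) simp
qed

end
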